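(* Let $n\ge 3$, let $k$ be a positive integer, and let $h(t)=a_0+a_2t^2+\dots+a_{2s}t^{2s}$ be an even univariate real polynomial which is nonnegative on $[-1,1]$. Let $h(t)=\sum_{j=0}^{s}\lambda_{2j}g_{2j}(t)$ be the unique expression of $h$ as a linear combination of normalized Gegenbauer polynomials (and put $\lambda_{2j}=0$ for $j>s$). If \[f=\|x\|^{2k}f_0+\|x\|^{2(k-1)}f_2+\|x\|^{2(k-2)}f_4+\dots+f_{2k}\] is the unique harmonic expansion of $f\in R_{2k}$ (with $f_{2j}\in H_{2j}$), then \[\hat{\Gamma}_h(f)=\lambda_0\|x\|^{2k}f_0+\lambda_2\|x\|^{2(k-1)}f_2+\lambda_4\|x\|^{2(k-2)}f_4+\dots+\lambda_{2k}f_{2k}.\]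
   Context: $S\subseteq\mathbb{R}^n$ is the unit sphere, $\mu$ is the $(n-1)$-dimensional area measure on $S$, $R_d\subseteq\mathbb{R}[x_1,\dots,x_n]$ is the space of homogeneous polynomials of degree $d$, and $H_d\subseteq R_d$ is the subspace of harmonic ones ($\Delta F=0$). Every $f\in R_{2k}$ can be written uniquely as $f=\sum_{j=0}^k\|x\|^{2(k-j)}f_{2j}$ with $f_{2j}\in H_{2j}$ (the harmonic expansion). With $\alpha=\frac{n-2}{2}$, the Gegenbauer polynomials are given by $C_0^{(\alpha)}(t)=1$, $C_1^{(\alpha)}(t)=2\alpha t$, and $C_j^{(\alpha)}(t)=\frac1j\left[2t(j+\alpha-1)C_{j-1}^{(\alpha)}(t)-(j+2\alpha-2)C_{j-2}^{(\alpha)}(t)\right]$ for $j\ge2$. The normalized Gegenbauer polynomials are $g_j(t)=\frac{\dim(H_j)}{\mu(S)\,C_j^{(\alpha)}(1)}C_j^{(\alpha)}(t)$. The linear map $\hat{\Gamma}_h:R_{2k}\to R_{2k}$ is $\hat{\Gamma}_h(f)(x)=\sum_{j=0}^s a_{2j}\|x\|^{2(k-j)}\int_S\langle x,y\rangle^{2j}f(y)\,d\mu(y)$ (for $j>k$ this is division by $\|x\|^{2(j-k)}$, and the quotient is a polynomial). *)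

theory Defs
  imports
    "HOL-Analysis.Analysis"
    "HOL-Computational_Algebra.Polynomial"
    "HOL-Library.Function_Algebras"
begin

text \<open>
  Polynomials in \<open>n = CARD('n)\<close> variables are identified with the functions they induce on
  \<open>real ^ 'n\<close>, which is harmless over the infinite field of reals.
\<close>

definition homogeneous_polys :: "nat \<Rightarrow> (real ^ 'n \<Rightarrow> real) set" where
  "homogeneous_polys d =
     {F. \<exists>c :: ('n \<Rightarrow> nat) \<Rightarrow> real.
           F = (\<lambda>x. \<Sum>a \<in> {a. (\<Sum>i\<in>UNIV. a i) = d}. c a * (\<Prod>i\<in>UNIV. (x $ i) ^ a i))}"

definition partial_deriv :: "'n \<Rightarrow> (real ^ 'n \<Rightarrow> real) \<Rightarrow> real ^ 'n \<Rightarrow> real" where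
  "partial_deriv i F x = deriv (\<lambda>t. F (x + t *\<^sub>R axis i 1)) 0"

definition laplacian :: "(real ^ 'n \<Rightarrow> real) \<Rightarrow> real ^ 'n \<Rightarrow> real" where
  "laplacian F x = (\<Sum>i\<in>UNIV. partial_deriv i (partial_deriv i F) x)"

definition harmonic_polys :: "nat \<Rightarrow> (real ^ 'n \<Rightarrow> real) set" where
  "harmonic_polys d = {F \<in> homogeneous_polys d. \<forall>x. laplacian F x = 0}"

definition fun_scale :: "real \<Rightarrow> ('a \<Rightarrow> real) \<Rightarrow> 'a \<Rightarrow> real" where
  "fun_scale c F = (\<lambda>x. c * F x)"

lemma vector_space_fun_scale: "vector_space fun_scale"
  by unfold_locales (auto simp: fun_scale_def fun_eq_iff algebra_simps)

text \<open>
  The \<open>(n-1)\<close>-dimensional area measure on the unit sphere: the area of a Borel set \<open>A\<close> is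
  \<open>n\<close> times the volume of the cone \<open>{r y | 0 < r < 1, y \<in> A}\<close> over it.
\<close>

definition sphere_measure :: "(real ^ 'n) measure" where
  "sphere_measure =
     scale_measure (of_nat CARD('n))
       (distr (restrict_space lborel (ball 0 1 - {0})) (restrict_space borel (sphere 0 1))
          (\<lambda>x. x /\<^sub>R norm x))"

lemma emeasure_sphere_measure:
  fixes A :: "(real ^ 'n) set"
  assumes "A \<in> sets borel" "A \<subseteq> sphere 0 1"
  shows "emeasure sphere_measure A =
           of_nat CARD('n) * emeasure lborel {r *\<^sub>R y | r y. 0 < r \<and> r < 1 \<and> y \<in> A}"
proof -
  let ?B = "ball 0 1 - {0 :: real ^ 'n}" and ?p = "\<lambda>x :: real ^ 'n. x /\<^sub>R norm x"
  have B: "?B \<in> sets borel" by auto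
  have "?p \<in> borel_measurable borel" by measurable
  then have m: "?p \<in> measurable (restrict_space lborel ?B) (restrict_space borel (sphere 0 1))"
    by (intro measurable_restrict_space2 measurable_restrict_space1)
       (auto simp: space_restrict_space)
  have A: "A \<in> sets (restrict_space borel (sphere 0 1))"
    using assms by (auto simp: sets_restrict_space_iff)
  have cone: "?p -` A \<inter> ?B = {r *\<^sub>R y | r y. 0 < r \<and> r < 1 \<and> y \<in> A}" (is "?L = ?R")
  proof
    show "?L \<subseteq> ?R"
    proof
      fix x assume "x \<in> ?L"
      then have "x = norm x *\<^sub>R ?p x" "0 < norm x" "norm x < 1" "?p x \<in> A" by auto
      then show "x \<in> ?R" by blast
    qed
    show "?R \<subseteq> ?L" using assms(2) by (fastforce simp: subset_iff)
  qed
  show ?thesis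
    unfolding sphere_measure_def cone[symmetric]
    using m A B by (simp add: emeasure_distr emeasure_restrict_space space_restrict_space)
qed

fun gegenbauer :: "real \<Rightarrow> nat \<Rightarrow> real poly" where
  "gegenbauer \<alpha> 0 = 1"
| "gegenbauer \<alpha> (Suc 0) = [:0, 2 * \<alpha>:]"
| "gegenbauer \<alpha> (Suc (Suc j)) =
     smult (1 / real (j + 2))
       ([:0, 2 * (real (j + 2) + \<alpha> - 1):] * gegenbauer \<alpha> (Suc j)
        - smult (real (j + 2) + 2 * \<alpha> - 2) (gegenbauer \<alpha> j))"

definition normalized_gegenbauer :: "'n::finite itself \<Rightarrow> nat \<Rightarrow> real poly" where
  "normalized_gegenbauer n j =
     (let \<alpha> = (real CARD('n) - 2) / 2 in
      smult (real (vector_space.dim fun_scale (harmonic_polys j :: (real ^ 'n \<Rightarrow> real) set))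
             / (measure (sphere_measure :: (real ^ 'n) measure) (sphere 0 1)
                * poly (gegenbauer \<alpha> j) 1))
        (gegenbauer \<alpha> j))"

text \<open>
  For \<open>j > k\<close> the exponent below is negative and the formula is a division by
  \<open>norm x ^ (2 * (j - k))\<close>. At \<open>x = 0\<close> this division yields \<open>0\<close> in HOL, which for \<open>k > 0\<close> is the
  value there of the quotient polynomial (a form of degree \<open>2 * k\<close>).
\<close>

definition Gamma_hat ::
    "nat \<Rightarrow> real poly \<Rightarrow> (real ^ 'n \<Rightarrow> real) \<Rightarrow> real ^ 'n \<Rightarrow> real" where
  "Gamma_hat k h f x =
     (\<Sum>j\<le>degree h div 2.
        coeff h (2 * j) * norm x powi (2 * (int k - int j))
          * (LINT y|sphere_measure. (x \<bullet> y) ^ (2 * j) * f y))"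

end

theory Submission
  imports Defs
begin

text \<open>
  It suffices to show that \<open>g\<^sub>j (u \<bullet> y)\<close>, for a unit vector \<open>u\<close>, integrates against \<open>F \<in> H\<^sub>d\<close> to \<open>F u\<close>
  if \<open>j = d\<close> and to \<open>0\<close> otherwise. On the sphere \<open>(u \<bullet> y) * F y\<close> splits into harmonic parts of
  degrees \<open>d + 1\<close> and \<open>d - 1\<close>, the latter a multiple of the derivative of \<open>F\<close> in direction \<open>u\<close>; by
  Euler's identity the values of both parts at \<open>u\<close> are explicit multiples of \<open>F u\<close>. The three-term
  recurrence of \<open>C\<^sub>j\<close> therefore reduces the claim, by induction on \<open>j\<close>, to the fact that harmonic forms
  of positive degree have mean zero, and yields the factor \<open>\<mu>(S) * \<alpha> / (\<alpha> + d)\<close> for \<open>j = d\<close>.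
  The normalisation in \<open>g\<^sub>d\<close> matches this factor because \<open>dim H\<^sub>d = (\<alpha> + d) / \<alpha> * C\<^sub>d(1)\<close>, which is
  the trace of the reproducing kernel.
\<close>

subsection \<open>Homogeneous polynomials and their derivatives\<close>

text \<open>The kernel identity is a form of the Funk-Hecke formula, usually derived from rotation
  invariance. Here the pole \<open>u\<close> stays fixed while \<open>F\<close> varies: an induction
  quantified over all \<open>d\<close> and \<open>F\<close> is closed under the recurrence, and only
  values at \<open>u\<close> have to be tracked. A general form is never decomposed; only the
  product of a linear and a harmonic form is split, by an explicit formula.

  Since the area measure is given by volumes of cones, the analytic work takes place in the unit
  ball, where a form of degree \<open>d\<close> integrates to its sphere integral divided by
  \<open>n + d\<close>. The dependence of this factor on \<open>d\<close> is what forces mean zero.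
  A cutoff vanishing to second order at the sphere avoids boundary terms and reduces integration by
  parts to translation invariance of Lebesgue measure.

  Counting monomials to find the dimension of \<open>H_d\<close> would require surjectivity of the
  Laplacian from \<open>R_d\<close> to \<open>R_(d-2)\<close>; the trace argument rests on the
  reproducing property instead.\<close>

lemma finite_multiindices: "finite {a :: 'n::finite \<Rightarrow> nat. (\<Sum>i\<in>UNIV. a i) = d}"
proof (rule finite_subset)
  show "{a :: 'n \<Rightarrow> nat. (\<Sum>i\<in>UNIV. a i) = d} \<subseteq> (\<Pi>\<^sub>E i\<in>UNIV. {..d})"
    by (auto simp: PiE_def extensional_def intro: member_le_sum)
qed (auto intro: finite_PiE)

lemma homogeneous_polys_add:
  assumes "F \<in> homogeneous_polys d" "G \<in> homogeneous_polys d"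
  shows "(\<lambda>x. F x + G x) \<in> homogeneous_polys d"
proof -
  obtain c c' where "F = (\<lambda>x. \<Sum>a \<in> {a. (\<Sum>i\<in>UNIV. a i) = d}. c a * (\<Prod>i\<in>UNIV. (x $ i) ^ a i))"
    "G = (\<lambda>x. \<Sum>a \<in> {a. (\<Sum>i\<in>UNIV. a i) = d}. c' a * (\<Prod>i\<in>UNIV. (x $ i) ^ a i))"
    using assms unfolding homogeneous_polys_def by blast
  then show ?thesis
    unfolding homogeneous_polys_def
    by (auto intro!: exI[of _ "\<lambda>a. c a + c' a"] simp: fun_eq_iff sum.distrib algebra_simps)
qed

lemma homogeneous_polys_cmult:
  assumes "F \<in> homogeneous_polys d"
  shows "(\<lambda>x. r * F x) \<in> homogeneous_polys d"
proof -
  obtain c where "F = (\<lambda>x. \<Sum>a \<in> {a. (\<Sum>i\<in>UNIV. a i) = d}. c a * (\<Prod>i\<in>UNIV. (x $ i) ^ a i))"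
    using assms unfolding homogeneous_polys_def by blast
  then show ?thesis
    unfolding homogeneous_polys_def
    by (auto intro!: exI[of _ "\<lambda>a. r * c a"] simp: fun_eq_iff sum_distrib_left algebra_simps)
qed

lemma homogeneous_polys_zero: "(\<lambda>x. 0) \<in> homogeneous_polys d"
  unfolding homogeneous_polys_def by (auto intro!: exI[of _ "\<lambda>a. 0"])

text \<open>Serves the Kronecker delta in the product rule for \<open>x $ j * F x\<close>.\<close>

lemma homogeneous_polys_if:
  "F \<in> homogeneous_polys d \<Longrightarrow> (\<lambda>x. if b then F x else 0) \<in> homogeneous_polys d"
  by (cases b) (auto intro: homogeneous_polys_zero)

lemma homogeneous_polys_diff:
  "F \<in> homogeneous_polys d \<Longrightarrow> G \<in> homogeneous_polys d \<Longrightarrow> (\<lambda>x. F x - G x) \<in> homogeneous_polys d"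
  using homogeneous_polys_add[of F d "\<lambda>x. - 1 * G x"] homogeneous_polys_cmult[of G d "-1"] by simp

lemma homogeneous_polys_sum:
  "(\<And>i. i \<in> I \<Longrightarrow> F i \<in> homogeneous_polys d) \<Longrightarrow> (\<lambda>x. \<Sum>i\<in>I. F i x) \<in> homogeneous_polys d"
  by (induction I rule: infinite_finite_induct)
     (auto intro: homogeneous_polys_zero homogeneous_polys_add)

lemma monomial_homogeneous_polys:
  assumes "(\<Sum>i\<in>UNIV. a i) = d"
  shows "(\<lambda>x :: real ^ 'n. \<Prod>i\<in>UNIV. (x $ i) ^ a i) \<in> homogeneous_polys d"
proof -
  have "(\<lambda>x :: real ^ 'n. \<Prod>i\<in>UNIV. (x $ i) ^ a i) =
    (\<lambda>x. \<Sum>b \<in> {b. (\<Sum>i\<in>UNIV. b i) = d}. (if b = a then 1 else 0) * (\<Prod>i\<in>UNIV. (x $ i) ^ b i))"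
  proof
    fix x :: "real ^ 'n"
    have "(\<Sum>b \<in> {b. (\<Sum>i\<in>UNIV. b i) = d}. (if b = a then 1 else 0) * (\<Prod>i\<in>UNIV. (x $ i) ^ b i))
        = (\<Sum>b \<in> {b. (\<Sum>i\<in>UNIV. b i) = d}. if b = a then \<Prod>i\<in>UNIV. (x $ i) ^ a i else 0)"
      by (rule sum.cong) auto
    then show "(\<Prod>i\<in>UNIV. (x $ i) ^ a i) =
      (\<Sum>b \<in> {b. (\<Sum>i\<in>UNIV. b i) = d}. (if b = a then 1 else 0) * (\<Prod>i\<in>UNIV. (x $ i) ^ b i))"
      using assms by (simp add: finite_multiindices)
  qed
  then show ?thesis
    unfolding homogeneous_polys_def by (intro CollectI exI[of _ "\<lambda>b. if b = a then 1 else 0"])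
qed

lemma homogeneous_polys_const: "(\<lambda>x. r) \<in> homogeneous_polys 0"
  using homogeneous_polys_cmult[OF monomial_homogeneous_polys[of "\<lambda>_. 0" 0], of r] by simp

lemma monomial_Suc:
  fixes x :: "real ^ 'n"
  shows "(\<Prod>j\<in>UNIV. (x $ j) ^ (a(i := Suc (a i))) j) = x $ i * (\<Prod>j\<in>UNIV. (x $ j) ^ a j)"
  by (simp add: prod.remove[of UNIV i] )

lemma homogeneous_polys_coord_mult:
  fixes F :: "real ^ 'n \<Rightarrow> real"
  assumes "F \<in> homogeneous_polys d"
  shows "(\<lambda>x. x $ i * F x) \<in> homogeneous_polys (Suc d)"
proof -
  obtain c where F: "F = (\<lambda>x. \<Sum>a \<in> {a. (\<Sum>i\<in>UNIV. a i) = d}. c a * (\<Prod>i\<in>UNIV. (x $ i) ^ a i))"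
    using assms unfolding homogeneous_polys_def by blast
  have "(\<lambda>x. \<Sum>a \<in> {a. (\<Sum>i\<in>UNIV. a i) = d}.
      c a * (\<Prod>j\<in>UNIV. ((x :: real ^ 'n) $ j) ^ (a(i := Suc (a i))) j)) \<in> homogeneous_polys (Suc d)"
    by (intro homogeneous_polys_sum homogeneous_polys_cmult monomial_homogeneous_polys)
       (auto simp: sum.remove[of UNIV i])
  then show ?thesis
    unfolding F monomial_Suc by (simp add: sum_distrib_left mult_ac)
qed

text \<open>Peeling one coordinate at a time off each monomial generates all forms from constants,
  so later properties can be proved without touching coefficients. The degree is an argument of
  \<open>P\<close> because \<open>coord_mult\<close> changes it; \<open>zero\<close> is the empty
  sum, which occurs in every degree.\<close>

lemma homogeneous_polys_induct [consumes 1, case_names zero const add coord_mult]: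
  fixes F :: "real ^ 'n \<Rightarrow> real"
  assumes F: "F \<in> homogeneous_polys d"
    and zero: "\<And>d. P d (\<lambda>x. 0)"
    and const: "\<And>r. P 0 (\<lambda>x. r)"
    and add: "\<And>d F G. F \<in> homogeneous_polys d \<Longrightarrow> P d F \<Longrightarrow> G \<in> homogeneous_polys d \<Longrightarrow> P d G
                \<Longrightarrow> P d (\<lambda>x. F x + G x)"
    and coord_mult: "\<And>d F i. F \<in> homogeneous_polys d \<Longrightarrow> P d F \<Longrightarrow> P (Suc d) (\<lambda>x. x $ i * F x)"
  shows "P d F"
proof -
  have mono: "P d (\<lambda>x. r * (\<Prod>i\<in>UNIV. (x $ i) ^ a i))"
    if "(\<Sum>i\<in>UNIV. a i) = d" for a :: "'n \<Rightarrow> nat" and r d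
    using that
  proof (induction d arbitrary: a)
    case 0
    then show ?case using const by simp
  next
    case (Suc d)
    then obtain i where i: "a i > 0" by (metis Zero_not_Suc neq0_conv sum.neutral)
    define b where "b = a(i := a i - 1)"
    have a: "a = b(i := Suc (b i))" using i by (auto simp: b_def)
    have sb: "(\<Sum>i\<in>UNIV. b i) = d"
      using Suc.prems unfolding a by (simp add: sum.remove[of UNIV i])
    have "P (Suc d) (\<lambda>x. x $ i * (r * (\<Prod>i\<in>UNIV. (x $ i) ^ b i)))"
      by (intro coord_mult Suc.IH[OF sb] homogeneous_polys_cmult monomial_homogeneous_polys sb)
    then show ?case
      unfolding a monomial_Suc by (simp add: mult_ac)
  qed
  obtain c where F: "F = (\<lambda>x. \<Sum>a \<in> {a. (\<Sum>i\<in>UNIV. a i) = d}. c a * (\<Prod>i\<in>UNIV. (x $ i) ^ a i))"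
    using F unfolding homogeneous_polys_def by blast
  have "P d (\<lambda>x. \<Sum>a \<in> A. c a * (\<Prod>i\<in>UNIV. (x $ i) ^ a i))"
    if "finite A" "A \<subseteq> {a. (\<Sum>i\<in>UNIV. a i) = d}" for A
    using that
  proof (induction A rule: finite_induct)
    case empty
    then show ?case using zero by simp
  next
    case (insert a A)
    then show ?case
      by (auto intro!: add mono homogeneous_polys_cmult homogeneous_polys_sum
          monomial_homogeneous_polys)
  qed
  then show ?thesis unfolding F using finite_multiindices by blast
qed

lemma homogeneous_polys_mult:
  assumes "F \<in> homogeneous_polys d" "G \<in> homogeneous_polys e"
  shows "(\<lambda>x. F x * G x) \<in> homogeneous_polys (d + e)"
  using assms(1)
proof (induction rule: homogeneous_polys_induct)
  case (coord_mult d F i)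
  then show ?case
    using homogeneous_polys_coord_mult[of "\<lambda>x. F x * G x" "d + e" i] by (simp add: mult.assoc)
qed (auto simp: distrib_right
      intro: homogeneous_polys_zero homogeneous_polys_cmult homogeneous_polys_add assms(2))

lemma homogeneous_polys_inner: "(\<lambda>x. u \<bullet> x) \<in> homogeneous_polys (Suc 0)"
proof -
  have "(\<lambda>x. \<Sum>i\<in>UNIV. u $ i * (x $ i * 1)) \<in> homogeneous_polys (Suc 0)"
    by (intro homogeneous_polys_sum homogeneous_polys_cmult homogeneous_polys_coord_mult
        homogeneous_polys_const)
  then show ?thesis by (simp add: inner_vec_def)
qed

lemma norm_square_vec: "(norm (x :: real ^ 'n))\<^sup>2 = (\<Sum>i\<in>UNIV. x $ i * x $ i)"
  unfolding power2_norm_eq_inner inner_vec_def by simp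

lemma homogeneous_polys_norm_square: "(\<lambda>x. (norm x)\<^sup>2) \<in> homogeneous_polys 2"
proof -
  have "(\<lambda>x. \<Sum>i\<in>UNIV. x $ i * (x $ i * 1)) \<in> homogeneous_polys (Suc (Suc 0))"
    by (intro homogeneous_polys_sum homogeneous_polys_coord_mult homogeneous_polys_const)
  then show ?thesis unfolding norm_square_vec by (simp add: numeral_2_eq_2)
qed

lemma homogeneous_polys_scaleR:
  assumes "F \<in> homogeneous_polys d"
  shows "F (r *\<^sub>R x) = r ^ d * F x"
  using assms by (induction rule: homogeneous_polys_induct) (auto simp: algebra_simps)

section \<open>Differentiability of forms and rules for partial derivatives\<close>

lemma homogeneous_polys_differentiable:
  fixes F :: "real ^ 'n \<Rightarrow> real"
  assumes "F \<in> homogeneous_polys d"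
  shows "F differentiable (at x)"
  using assms
proof (induction rule: homogeneous_polys_induct)
  case (coord_mult d F i)
  have "(\<lambda>x :: real ^ 'n. x $ i) differentiable (at x)"
    using bounded_linear_imp_has_derivative[OF bounded_linear_vec_nth] differentiableI by blast
  then show ?case using coord_mult.IH by (intro differentiable_mult)
qed auto

lemma homogeneous_polys_continuous_on:
  assumes "F \<in> homogeneous_polys d"
  shows "continuous_on A F"
  using differentiable_imp_continuous_within[OF homogeneous_polys_differentiable[OF assms]]
  by (simp add: continuous_at_imp_continuous_on)

lemma has_partial_deriv:
  fixes F :: "real ^ 'n \<Rightarrow> real"
  assumes "(F has_derivative F') (at x)"
  shows "((\<lambda>t. F (x + t *\<^sub>R axis i 1)) has_real_derivative F' (axis i 1)) (at 0)"
proof -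
  interpret bounded_linear F' using assms by (rule has_derivative_bounded_linear)
  have "((\<lambda>t. F (x + t *\<^sub>R axis i 1)) has_derivative (\<lambda>t. F' (t *\<^sub>R axis i 1))) (at 0)"
    by (rule has_derivative_compose[of _ _ 0 UNIV F])
       (use assms in \<open>auto intro!: derivative_eq_intros\<close>)
  then show ?thesis by (simp add: has_field_derivative_def scaleR mult.commute[of _ "F' _"])
qed

lemma partial_deriv_eq:
  fixes F :: "real ^ 'n \<Rightarrow> real"
  assumes "(F has_derivative F') (at x)"
  shows "partial_deriv i F x = F' (axis i 1)"
  unfolding partial_deriv_def by (rule DERIV_imp_deriv[OF has_partial_deriv[OF assms]])

lemma homogeneous_polys_has_derivative:
  fixes F :: "real ^ 'n \<Rightarrow> real"
  assumes "F \<in> homogeneous_polys d"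
  shows "(F has_derivative (\<lambda>h. \<Sum>i\<in>UNIV. h $ i * partial_deriv i F x)) (at x)"
proof -
  obtain F' where F': "(F has_derivative F') (at x)"
    using homogeneous_polys_differentiable[OF assms] unfolding differentiable_def by blast
  interpret bounded_linear F' using F' by (rule has_derivative_bounded_linear)
  have "F' h = (\<Sum>i\<in>UNIV. h $ i * partial_deriv i F x)" for h
  proof -
    have "F' h = F' (\<Sum>i\<in>UNIV. h $ i *\<^sub>R axis i 1)"
      using basis_expansion[of h] by (simp add: scalar_mult_eq_scaleR)
    then show ?thesis by (simp add: sum scaleR partial_deriv_eq[OF F'])
  qed
  then have "F' = (\<lambda>h. \<Sum>i\<in>UNIV. h $ i * partial_deriv i F x)" by blast
  then show ?thesis using F' by simp
qed

text \<open>\<open>deriv\<close> is a choice operator and says nothing unless a derivative exists.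
  For forms it exists, and this is the fact from which the sum and product rules start.\<close>

lemma homogeneous_polys_DERIV:
  assumes "F \<in> homogeneous_polys d"
  shows "((\<lambda>t. F (x + t *\<^sub>R axis i 1)) has_real_derivative partial_deriv i F x) (at 0)"
  using has_partial_deriv[OF homogeneous_polys_has_derivative[OF assms], of x i]
  by (simp add: axis_def if_distrib[of "\<lambda>x. x * _"] cong: if_cong)

lemma partial_deriv_const: "partial_deriv i (\<lambda>x. r) = (\<lambda>x. 0)"
  unfolding partial_deriv_def by simp

lemma partial_deriv_coord:
  "partial_deriv i (\<lambda>x. x $ j) = (\<lambda>x. if i = j then 1 else 0)"
proof
  fix x :: "real ^ 'a"
  have "((\<lambda>x :: real ^ 'a. x $ j) has_derivative (\<lambda>x. x $ j)) (at x)"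
    by (rule bounded_linear_imp_has_derivative[OF bounded_linear_vec_nth])
  from partial_deriv_eq[OF this, of i]
  show "partial_deriv i (\<lambda>x. x $ j) x = (if i = j then 1 else 0)"
    by (simp add: axis_def)
qed

lemma partial_deriv_add:
  assumes "F \<in> homogeneous_polys d" "G \<in> homogeneous_polys e"
  shows "partial_deriv i (\<lambda>x. F x + G x) = (\<lambda>x. partial_deriv i F x + partial_deriv i G x)"
proof
  fix x
  show "partial_deriv i (\<lambda>x. F x + G x) x = partial_deriv i F x + partial_deriv i G x"
    using DERIV_imp_deriv[OF DERIV_add[OF assms[THEN homogeneous_polys_DERIV]]] by (simp add: partial_deriv_def)
qed

lemma partial_deriv_mult:
  assumes "F \<in> homogeneous_polys d" "G \<in> homogeneous_polys e"
  shows "partial_deriv i (\<lambda>x. F x * G x) = (\<lambda>x. partial_deriv i F x * G x + F x * partial_deriv i G x)"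
proof
  fix x
  show "partial_deriv i (\<lambda>x. F x * G x) x = partial_deriv i F x * G x + F x * partial_deriv i G x"
    using DERIV_imp_deriv[OF DERIV_mult[OF assms[THEN homogeneous_polys_DERIV]]] by (simp add: partial_deriv_def mult.commute)
qed

lemma partial_deriv_cmult:
  assumes "F \<in> homogeneous_polys d"
  shows "partial_deriv i (\<lambda>x. r * F x) = (\<lambda>x. r * partial_deriv i F x)"
  using partial_deriv_mult[OF homogeneous_polys_const assms] by (simp add: partial_deriv_const)

lemma partial_deriv_sum:
  assumes "\<And>j. j \<in> J \<Longrightarrow> F j \<in> homogeneous_polys d"
  shows "partial_deriv i (\<lambda>x. \<Sum>j\<in>J. F j x) = (\<lambda>x. \<Sum>j\<in>J. partial_deriv i (F j) x)"
  using assms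
proof (induction J rule: infinite_finite_induct)
  case (insert j J)
  then show ?case
    by (simp add: partial_deriv_add[of "F j" d "\<lambda>x. \<Sum>j\<in>J. F j x" d] homogeneous_polys_sum)
qed (auto simp: partial_deriv_const)

lemma partial_deriv_coord_mult:
  assumes "F \<in> homogeneous_polys d"
  shows "partial_deriv i (\<lambda>x. x $ j * F x) =
    (\<lambda>x. (if i = j then F x else 0) + x $ j * partial_deriv i F x)"
proof -
  have "(\<lambda>x. x $ j) \<in> homogeneous_polys (Suc 0)"
    using homogeneous_polys_coord_mult[OF homogeneous_polys_const[of 1]] by simp
  from partial_deriv_mult[OF this assms, of i] show ?thesis
    by (auto simp: partial_deriv_coord fun_eq_iff)
qed

text \<open>Truncated subtraction is harmless: in degree 0 the derivative is zero, which is a form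
  of every degree. The product case splits on \<open>d\<close> because
  \<open>x $ j * partial_deriv i F x\<close> has degree \<open>Suc (d - 1)\<close>, which is
  \<open>d\<close> only for positive \<open>d\<close>.\<close>

lemma partial_deriv_homogeneous_polys:
  assumes "F \<in> homogeneous_polys d"
  shows "partial_deriv i F \<in> homogeneous_polys (d - 1)"
  using assms
proof (induction rule: homogeneous_polys_induct)
  case (add d F G)
  then show ?case by (auto simp: partial_deriv_add intro!: homogeneous_polys_add)
next
  case (coord_mult d F j)
  show ?case
  proof (cases d)
    case 0
    with coord_mult have "F \<in> homogeneous_polys 0" by simp
    then obtain r where "F = (\<lambda>x. r)" by (auto simp: homogeneous_polys_def)
    then show ?thesis
      using partial_deriv_coord_mult[of F 0 i j] 0 coord_mult.hyps
      by (auto simp: partial_deriv_const intro: homogeneous_polys_const)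
  next
    case (Suc e)
    then show ?thesis
      using coord_mult homogeneous_polys_coord_mult[of "partial_deriv i F" e j]
      by (auto simp: partial_deriv_coord_mult intro!: homogeneous_polys_add homogeneous_polys_if)
  qed
qed (auto simp: partial_deriv_const intro: homogeneous_polys_zero)

lemma partial_deriv_degree_0: "F \<in> homogeneous_polys 0 \<Longrightarrow> partial_deriv i F = (\<lambda>x. 0)"
  by (auto simp: homogeneous_polys_def partial_deriv_const)

lemma partial_deriv_commute:
  assumes "F \<in> homogeneous_polys d"
  shows "partial_deriv i (partial_deriv j F) = partial_deriv j (partial_deriv i F)"
  using assms
proof (induction rule: homogeneous_polys_induct)
  case (add d F G)
  note H = partial_deriv_homogeneous_polys
  show ?case
    using add by (simp add: partial_deriv_add[OF add.hyps] partial_deriv_add[OF H H])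
next
  case (coord_mult d F k)
  note H = partial_deriv_homogeneous_polys[OF coord_mult.hyps]
  have "partial_deriv i (partial_deriv j (\<lambda>x. x $ k * F x)) = (\<lambda>x. (if j = k then partial_deriv i F x else 0) +
      ((if i = k then partial_deriv j F x else 0) + x $ k * partial_deriv i (partial_deriv j F) x))" for i j
    unfolding partial_deriv_coord_mult[OF coord_mult.hyps]
    \<comment> \<open>The sum rule allows different degrees, so the second summand may keep degree
      \<open>Suc (d - 1)\<close> even when \<open>d = 0\<close>.\<close>
    by (subst partial_deriv_add[of _ d _ "Suc (d - 1)"])
       (auto simp: partial_deriv_coord_mult[OF H] partial_deriv_const simp del: One_nat_def
         intro!: homogeneous_polys_coord_mult H homogeneous_polys_if coord_mult.hyps)
  then show ?case using coord_mult.IH by (auto simp: fun_eq_iff)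
qed (auto simp: partial_deriv_const)

lemma euler_homogeneous:
  assumes "F \<in> homogeneous_polys d"
  shows "(\<Sum>i\<in>UNIV. x $ i * partial_deriv i F x) = real d * F x"
  using assms
proof (induction rule: homogeneous_polys_induct)
  case (coord_mult d F j)
  have "(\<Sum>i\<in>UNIV. x $ i * ((if i = j then F x else 0) + x $ j * partial_deriv i F x)) =
     (\<Sum>i\<in>UNIV. (if i = j then x $ j * F x else 0) + x $ j * (x $ i * partial_deriv i F x))"
    by (rule sum.cong) (auto simp: algebra_simps)
  also have "\<dots> = x $ j * F x + x $ j * (\<Sum>i\<in>UNIV. x $ i * partial_deriv i F x)"
    by (simp add: sum.distrib sum_distrib_left)
  finally show ?case
    unfolding partial_deriv_coord_mult[OF coord_mult.hyps] coord_mult.IH by (simp add: algebra_simps)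
qed (auto simp: partial_deriv_const partial_deriv_add sum.distrib distrib_left)

subsection \<open>The Laplacian and harmonic polynomials\<close>

lemma partial_deriv_inner: "partial_deriv i (\<lambda>x. u \<bullet> x) = (\<lambda>x. u $ i)"
proof
  fix x
  have "((\<lambda>x. u \<bullet> x) has_derivative (\<lambda>x. u \<bullet> x)) (at x)"
    by (rule bounded_linear_imp_has_derivative[OF bounded_linear_inner_right])
  from partial_deriv_eq[OF this, of i]
  show "partial_deriv i (\<lambda>x. u \<bullet> x) x = u $ i" by (simp add: inner_axis)
qed

lemma partial_deriv_norm_square: "partial_deriv i (\<lambda>x :: real ^ 'n. (norm x)\<^sup>2) = (\<lambda>x. 2 * x $ i)"
proof
  fix x :: "real ^ 'n"
  have "((\<lambda>x. (norm x)\<^sup>2) has_derivative (\<lambda>h. 2 * (x \<bullet> h))) (at x)"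
    unfolding power2_norm_eq_inner by (auto intro!: derivative_eq_intros simp: inner_commute)
  from partial_deriv_eq[OF this, of i]
  show "partial_deriv i (\<lambda>x. (norm x)\<^sup>2) x = 2 * x $ i" by (simp add: inner_axis)
qed

section \<open>Directional derivatives\<close>

definition dir_deriv :: "real ^ 'n \<Rightarrow> (real ^ 'n \<Rightarrow> real) \<Rightarrow> real ^ 'n \<Rightarrow> real" where
  "dir_deriv u F x = (\<Sum>i\<in>UNIV. u $ i * partial_deriv i F x)"

lemma dir_deriv_homogeneous_polys:
  assumes "F \<in> homogeneous_polys d"
  shows "dir_deriv u F \<in> homogeneous_polys (d - 1)"
  unfolding dir_deriv_def[abs_def]
  by (intro homogeneous_polys_sum homogeneous_polys_cmult partial_deriv_homogeneous_polys assms)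

lemma dir_deriv_degree_0: "F \<in> homogeneous_polys 0 \<Longrightarrow> dir_deriv u F = (\<lambda>x. 0)"
  by (simp add: dir_deriv_def[abs_def] partial_deriv_degree_0)

text \<open>With the direction equal to the base point, \<open>dir_deriv\<close> is the Euler
  operator. This makes both harmonic parts of \<open>(u \<bullet> y) * F y\<close> computable at the
  pole \<open>u\<close>.\<close>

lemma dir_deriv_self: "F \<in> homogeneous_polys d \<Longrightarrow> dir_deriv x F x = real d * F x"
  unfolding dir_deriv_def by (rule euler_homogeneous)

lemma dir_deriv_const: "dir_deriv u (\<lambda>x. r) = (\<lambda>x. 0)"
  by (simp add: dir_deriv_def[abs_def] partial_deriv_const)

lemma dir_deriv_cmult:
  "F \<in> homogeneous_polys d \<Longrightarrow> dir_deriv u (\<lambda>x. r * F x) = (\<lambda>x. r * dir_deriv u F x)"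
  by (simp add: dir_deriv_def[abs_def] partial_deriv_cmult sum_distrib_left mult_ac)

lemma dir_deriv_diff:
  assumes "F \<in> homogeneous_polys d" "G \<in> homogeneous_polys e"
  shows "dir_deriv u (\<lambda>x. F x - G x) = (\<lambda>x. dir_deriv u F x - dir_deriv u G x)"
proof -
  have "partial_deriv i (\<lambda>x. F x + (-1) * G x) = (\<lambda>x. partial_deriv i F x + (-1) * partial_deriv i G x)" for i
    unfolding partial_deriv_add[OF assms(1) homogeneous_polys_cmult[OF assms(2)]]
      partial_deriv_cmult[OF assms(2)] by (rule refl)
  then have "partial_deriv i (\<lambda>x. F x - G x) = (\<lambda>x. partial_deriv i F x - partial_deriv i G x)" for i
    by simp
  then show ?thesis
    by (simp add: dir_deriv_def[abs_def] sum_subtractf right_diff_distrib)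
qed

lemma dir_deriv_mult:
  assumes "F \<in> homogeneous_polys d" "G \<in> homogeneous_polys e"
  shows "dir_deriv u (\<lambda>x. F x * G x) = (\<lambda>x. dir_deriv u F x * G x + F x * dir_deriv u G x)"
  by (simp add: dir_deriv_def[abs_def] partial_deriv_mult[OF assms] sum_distrib_left sum_distrib_right
      sum.distrib algebra_simps)

lemma dir_deriv_inner: "dir_deriv u (\<lambda>x. v \<bullet> x) = (\<lambda>x. u \<bullet> v)"
  unfolding dir_deriv_def[abs_def] partial_deriv_inner by (simp add: inner_vec_def)

lemma dir_deriv_inner_mult:
  assumes "F \<in> homogeneous_polys d"
  shows "dir_deriv u (\<lambda>x. (v \<bullet> x) * F x) = (\<lambda>x. (u \<bullet> v) * F x + (v \<bullet> x) * dir_deriv u F x)"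
  by (simp add: dir_deriv_mult[OF homogeneous_polys_inner assms] dir_deriv_inner)

lemma dir_deriv_norm_square_mult:
  assumes "F \<in> homogeneous_polys d"
  shows "dir_deriv u (\<lambda>x. (norm x)\<^sup>2 * F x) =
    (\<lambda>x. 2 * (u \<bullet> x) * F x + (norm x)\<^sup>2 * dir_deriv u F x)"
proof -
  have "dir_deriv u (\<lambda>x. (norm x)\<^sup>2) = (\<lambda>x. 2 * (u \<bullet> x))"
    by (simp add: dir_deriv_def[abs_def] partial_deriv_norm_square inner_vec_def sum_distrib_left mult_ac)
  then show ?thesis by (simp add: dir_deriv_mult[OF homogeneous_polys_norm_square assms])
qed

section \<open>Leibniz rules for the Laplacian\<close>

lemma laplacian_const: "laplacian (\<lambda>x. r) x = 0"
  by (simp add: laplacian_def partial_deriv_const)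

lemma laplacian_add:
  assumes "F \<in> homogeneous_polys d" "G \<in> homogeneous_polys e"
  shows "laplacian (\<lambda>x. F x + G x) x = laplacian F x + laplacian G x"
  unfolding laplacian_def partial_deriv_add[OF assms]
    partial_deriv_add[OF assms[THEN partial_deriv_homogeneous_polys]] by (simp add: sum.distrib)

lemma laplacian_cmult:
  assumes "F \<in> homogeneous_polys d"
  shows "laplacian (\<lambda>x. r * F x) x = r * laplacian F x"
  unfolding laplacian_def partial_deriv_cmult[OF assms]
    partial_deriv_cmult[OF assms[THEN partial_deriv_homogeneous_polys]]
  by (simp add: sum_distrib_left)

lemma laplacian_diff:
  assumes "F \<in> homogeneous_polys d" "G \<in> homogeneous_polys e"
  shows "laplacian (\<lambda>x. F x - G x) x = laplacian F x - laplacian G x"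
proof -
  have "laplacian (\<lambda>x. F x + (-1) * G x) x = laplacian F x + (-1) * laplacian G x"
    unfolding laplacian_add[OF assms(1) homogeneous_polys_cmult[OF assms(2)]]
      laplacian_cmult[OF assms(2)] by (rule refl)
  then show ?thesis by simp
qed

lemma laplacian_mult:
  assumes F: "F \<in> homogeneous_polys d" and G: "G \<in> homogeneous_polys e"
  shows "laplacian (\<lambda>x. F x * G x) x = laplacian F x * G x
    + 2 * (\<Sum>i\<in>UNIV. partial_deriv i F x * partial_deriv i G x) + F x * laplacian G x"
proof -
  note F' = partial_deriv_homogeneous_polys[OF F]
  note G' = partial_deriv_homogeneous_polys[OF G]
  have "partial_deriv i (partial_deriv i (\<lambda>x. F x * G x)) x = partial_deriv i (partial_deriv i F) x * G x
    + 2 * (partial_deriv i F x * partial_deriv i G x) + F x * partial_deriv i (partial_deriv i G) x" for i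
    unfolding partial_deriv_mult[OF F G]
      partial_deriv_add[OF homogeneous_polys_mult[OF F' G] homogeneous_polys_mult[OF F G']]
      partial_deriv_mult[OF F' G] partial_deriv_mult[OF F G'] by simp
  then show ?thesis
    by (simp add: laplacian_def sum.distrib sum_distrib_left sum_distrib_right)
qed

lemma laplacian_inner_mult:
  assumes "F \<in> homogeneous_polys d"
  shows "laplacian (\<lambda>x. (u \<bullet> x) * F x) x = 2 * dir_deriv u F x + (u \<bullet> x) * laplacian F x"
  unfolding laplacian_mult[OF homogeneous_polys_inner assms]
  by (simp add: laplacian_def[of "\<lambda>x. u \<bullet> x"] partial_deriv_inner partial_deriv_const dir_deriv_def)

text \<open>The term \<open>2 * CARD('n)\<close> is the Laplacian of
  \<open>(norm x)\<^sup>2\<close>; the term \<open>4 * d\<close> is the cross term of the product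
  rule, evaluated by Euler's identity.\<close>

lemma laplacian_norm_square_mult:
  fixes F :: "real ^ 'n \<Rightarrow> real"
  assumes "F \<in> homogeneous_polys d"
  shows "laplacian (\<lambda>x. (norm x)\<^sup>2 * F x) x =
    (2 * real CARD('n) + 4 * real d) * F x + (norm x)\<^sup>2 * laplacian F x"
proof -
  have c: "(\<lambda>x :: real ^ 'n. x $ i) \<in> homogeneous_polys (Suc 0)" for i
    using homogeneous_polys_coord_mult[OF homogeneous_polys_const[of 1]] by simp
  have "laplacian (\<lambda>x :: real ^ 'n. (norm x)\<^sup>2) x = 2 * real CARD('n)"
    by (simp add: laplacian_def partial_deriv_norm_square partial_deriv_cmult[OF c] partial_deriv_coord)
  moreover have "(\<Sum>i\<in>UNIV. 2 * x $ i * partial_deriv i F x) = 2 * (real d * F x)"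
    unfolding euler_homogeneous[OF assms, of x, symmetric] sum_distrib_left
    by (rule sum.cong) (auto simp: mult_ac)
  ultimately show ?thesis
    unfolding laplacian_mult[OF homogeneous_polys_norm_square assms]
    by (simp add: partial_deriv_norm_square algebra_simps)
qed

text \<open>Operators with constant coefficients commute on forms, so the Laplacian of the
  derivative is the derivative of the vanishing Laplacian.\<close>

lemma harmonic_dir_deriv:
  assumes "F \<in> harmonic_polys d"
  shows "dir_deriv u F \<in> harmonic_polys (d - 1)"
proof -
  have F: "F \<in> homogeneous_polys d" and L: "\<And>x. laplacian F x = 0"
    using assms by (auto simp: harmonic_polys_def)
  note H = partial_deriv_homogeneous_polys
  have c: "partial_deriv i (partial_deriv i (partial_deriv j F)) = partial_deriv j (partial_deriv i (partial_deriv i F))" for i j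
    unfolding partial_deriv_commute[OF F, of i j] by (rule partial_deriv_commute[OF H[OF F]])
  have "partial_deriv i (partial_deriv i (dir_deriv u F)) x =
    (\<Sum>j\<in>UNIV. u $ j * partial_deriv j (partial_deriv i (partial_deriv i F)) x)" for i x
    unfolding dir_deriv_def[abs_def]
    by (simp add: partial_deriv_sum[OF homogeneous_polys_cmult, OF H[OF F]]
        partial_deriv_cmult[OF H[OF F]] partial_deriv_sum[OF homogeneous_polys_cmult, OF H[OF H[OF F]]]
        partial_deriv_cmult[OF H[OF H[OF F]]] c)
  then have 1: "laplacian (dir_deriv u F) x = (\<Sum>j\<in>UNIV. u $ j *
      (\<Sum>i\<in>UNIV. partial_deriv j (partial_deriv i (partial_deriv i F)) x))" for x
    unfolding laplacian_def
    by (simp add: sum_distrib_left) (rule sum.swap)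
  have "(\<Sum>i\<in>UNIV. partial_deriv j (partial_deriv i (partial_deriv i F)) x) =
      partial_deriv j (laplacian F) x" for j x
    unfolding laplacian_def[abs_def] by (simp add: partial_deriv_sum[OF H[OF H[OF F]]])
  moreover have "laplacian F = (\<lambda>x. 0)" using L by blast
  ultimately show ?thesis
    using dir_deriv_homogeneous_polys[OF F] by (simp add: harmonic_polys_def partial_deriv_const 1)
qed

text \<open>
  The Laplacian of \<open>(u \<bullet> x) * F x\<close> is \<open>2 * dir_deriv u F x\<close>, and the subtracted multiple of
  \<open>norm x ^ 2 * dir_deriv u F x\<close> has the same Laplacian when \<open>F\<close> is harmonic of degree \<open>d\<close>.
\<close>

definition raise_part :: "real ^ 'n \<Rightarrow> nat \<Rightarrow> (real ^ 'n \<Rightarrow> real) \<Rightarrow> real ^ 'n \<Rightarrow> real" where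
  "raise_part u d F x = (u \<bullet> x) * F x
     - (norm x)\<^sup>2 * (1 / (real CARD('n) + 2 * real d - 2) * dir_deriv u F x)"

lemma harmonic_cmult: "F \<in> harmonic_polys d \<Longrightarrow> (\<lambda>x. r * F x) \<in> harmonic_polys d"
  by (auto simp: harmonic_polys_def laplacian_cmult intro: homogeneous_polys_cmult)

lemma harmonic_raise_part:
  fixes F :: "real ^ 'n \<Rightarrow> real"
  assumes n: "CARD('n) \<ge> 3" and "F \<in> harmonic_polys d"
  shows "raise_part u d F \<in> harmonic_polys (Suc d)"
proof -
  have F: "F \<in> homogeneous_polys d" and L: "\<And>x. laplacian F x = 0"
    using assms by (auto simp: harmonic_polys_def)
  let ?c = "1 / (real CARD('n) + 2 * real d - 2)"
  note uF = homogeneous_polys_mult[OF homogeneous_polys_inner[of u] F]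
  have D: "(\<lambda>x. ?c * dir_deriv u F x) \<in> harmonic_polys (d - 1)"
    by (intro harmonic_cmult harmonic_dir_deriv assms)
  show ?thesis
  \<comment> \<open>For \<open>d = 0\<close> the truncated \<open>d - 1\<close> would assign degree
    2 instead of 1 to the subtracted term, but there the derivative vanishes.\<close>
  proof (cases d)
    case 0
    then show ?thesis
      using F uF unfolding raise_part_def[abs_def]
      by (simp add: harmonic_polys_def dir_deriv_degree_0 laplacian_inner_mult[OF F] L)
  next
    case (Suc e)
    then have G: "(\<lambda>x. ?c * dir_deriv u F x) \<in> homogeneous_polys e"
      and LG: "\<And>x. laplacian (\<lambda>x. ?c * dir_deriv u F x) x = 0"
      using D by (auto simp: harmonic_polys_def)
    note nG = homogeneous_polys_mult[OF homogeneous_polys_norm_square G]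
    have "raise_part u d F \<in> homogeneous_polys (Suc d)"
      unfolding raise_part_def[abs_def] using uF nG Suc by (intro homogeneous_polys_diff) auto
    moreover have "laplacian (raise_part u d F) x = 0" for x
    proof -
      \<comment> \<open>With \<open>d = Suc e\<close> the denominator in \<open>?c\<close> is
        \<open>n + 2 * e\<close>, half the factor that \<open>laplacian_norm_square_mult\<close>
        yields in degree \<open>e\<close>.\<close>
      have "(2 * real CARD('n) + 4 * real e) * ?c = 2"
        using n Suc by (simp add: field_simps)
      then have c: "(2 * real CARD('n) + 4 * real e) * (?c * dir_deriv u F x) = 2 * dir_deriv u F x"
        by (metis mult.assoc)
      have "laplacian (raise_part u d F) x =
        2 * dir_deriv u F x - (2 * real CARD('n) + 4 * real e) * (?c * dir_deriv u F x)"
        unfolding raise_part_def[abs_def] laplacian_diff[OF uF nG]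
          laplacian_norm_square_mult[OF G] laplacian_inner_mult[OF F] L LG by simp
      then show ?thesis unfolding c by simp
    qed
    ultimately show ?thesis by (simp add: harmonic_polys_def)
  qed
qed

subsection \<open>Zonal polynomials\<close>

text \<open>For \<open>x \<noteq> 0\<close> this is the homogenised Gegenbauer polynomial \<open>norm x ^ j * C\<^sub>j (u \<bullet> x / norm x)\<close>.\<close>

fun zonal :: "real \<Rightarrow> real ^ 'n \<Rightarrow> nat \<Rightarrow> real ^ 'n \<Rightarrow> real" where
  "zonal \<alpha> u 0 x = 1"
| "zonal \<alpha> u (Suc 0) x = 2 * \<alpha> * (u \<bullet> x)"
| "zonal \<alpha> u (Suc (Suc j)) x = 1 / real (j + 2) *
     (2 * (real (j + 2) + \<alpha> - 1) * ((u \<bullet> x) * zonal \<alpha> u (Suc j) x)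
      - (real (j + 2) + 2 * \<alpha> - 2) * ((norm x)\<^sup>2 * zonal \<alpha> u j x))"

lemma zonal_abs:
  "zonal \<alpha> u 0 = (\<lambda>x. 1)"
  "zonal \<alpha> u (Suc 0) = (\<lambda>x. 2 * \<alpha> * (u \<bullet> x))"
  "zonal \<alpha> u (Suc (Suc j)) = (\<lambda>x. 1 / real (j + 2) *
     (2 * (real (j + 2) + \<alpha> - 1) * ((u \<bullet> x) * zonal \<alpha> u (Suc j) x)
      - (real (j + 2) + 2 * \<alpha> - 2) * ((norm x)\<^sup>2 * zonal \<alpha> u j x)))"
  by (rule ext, simp)+

lemma zonal_homogeneous: "zonal \<alpha> u j \<in> homogeneous_polys j"
proof (induction j rule: induct_nat_012)
  case (ge2 j)
  have "(\<lambda>x. (u \<bullet> x) * zonal \<alpha> u (Suc j) x) \<in> homogeneous_polys (Suc (Suc j))"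
    using homogeneous_polys_mult[OF homogeneous_polys_inner ge2(2)] by simp
  moreover have "(\<lambda>x. (norm x)\<^sup>2 * zonal \<alpha> u j x) \<in> homogeneous_polys (Suc (Suc j))"
    using homogeneous_polys_mult[OF homogeneous_polys_norm_square ge2(1)] by simp
  ultimately show ?case
    unfolding zonal_abs by (intro homogeneous_polys_cmult homogeneous_polys_diff)
qed (auto simp only: zonal_abs intro: homogeneous_polys_const homogeneous_polys_cmult homogeneous_polys_inner)

lemma zonal_sphere: "norm x = 1 \<Longrightarrow> zonal \<alpha> u j x = poly (gegenbauer \<alpha> j) (u \<bullet> x)"
  by (induction j rule: induct_nat_012) (simp_all add: algebra_simps)

lemma dir_deriv_zonal_step:
  fixes u :: "real ^ 'n"
  shows "dir_deriv u (zonal \<alpha> u (Suc (Suc j))) x = 1 / real (j + 2) *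
     (2 * (real (j + 2) + \<alpha> - 1) * ((u \<bullet> u) * zonal \<alpha> u (Suc j) x + (u \<bullet> x) * dir_deriv u (zonal \<alpha> u (Suc j)) x)
      - (real (j + 2) + 2 * \<alpha> - 2) * (2 * (u \<bullet> x) * zonal \<alpha> u j x + (norm x)\<^sup>2 * dir_deriv u (zonal \<alpha> u j) x))"
proof -
  note Z = zonal_homogeneous[of \<alpha> u]
  note 1 = homogeneous_polys_mult[OF homogeneous_polys_inner[of u] Z[of "Suc j"]]
  note 2 = homogeneous_polys_mult[OF homogeneous_polys_norm_square Z[of "j"]]
  have e: "Suc 0 + Suc j = 2 + j" by simp
  show ?thesis
    unfolding zonal_abs
      dir_deriv_cmult[OF homogeneous_polys_diff[OF homogeneous_polys_cmult[OF 1, unfolded e] homogeneous_polys_cmult[OF 2]]]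
      dir_deriv_diff[OF homogeneous_polys_cmult[OF 1] homogeneous_polys_cmult[OF 2]]
      dir_deriv_cmult[OF 1] dir_deriv_cmult[OF 2]
      dir_deriv_inner_mult[OF Z] dir_deriv_norm_square_mult[OF Z] by (rule refl)
qed

lemma laplacian_zonal_step:
  fixes u :: "real ^ 'n"
  shows "laplacian (zonal \<alpha> u (Suc (Suc j))) x = 1 / real (j + 2) *
     (2 * (real (j + 2) + \<alpha> - 1) * (2 * dir_deriv u (zonal \<alpha> u (Suc j)) x + (u \<bullet> x) * laplacian (zonal \<alpha> u (Suc j)) x)
      - (real (j + 2) + 2 * \<alpha> - 2) * ((2 * real CARD('n) + 4 * real j) * zonal \<alpha> u j x
           + (norm x)\<^sup>2 * laplacian (zonal \<alpha> u j) x))"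
proof -
  note Z = zonal_homogeneous[of \<alpha> u]
  note 1 = homogeneous_polys_mult[OF homogeneous_polys_inner[of u] Z[of "Suc j"]]
  note 2 = homogeneous_polys_mult[OF homogeneous_polys_norm_square Z[of "j"]]
  have e: "Suc 0 + Suc j = 2 + j" by simp
  show ?thesis
    unfolding zonal_abs
      laplacian_cmult[OF homogeneous_polys_diff[OF homogeneous_polys_cmult[OF 1, unfolded e] homogeneous_polys_cmult[OF 2]]]
      laplacian_diff[OF homogeneous_polys_cmult[OF 1] homogeneous_polys_cmult[OF 2]]
      laplacian_cmult[OF 1] laplacian_cmult[OF 2]
      laplacian_inner_mult[OF Z] laplacian_norm_square_mult[OF Z] by (rule refl)
qed

text \<open>This is the coefficientwise form of differentiating the generating function \<open>(1 -
  2 * r * (u \<bullet> x) + r^2 * (norm x)^2) powr (- \<alpha>)\<close> of the zonal polynomials in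
  direction \<open>u\<close>. It holds for every \<open>\<alpha>\<close> and is derived here from
  the recurrence alone.\<close>

lemma dir_deriv_zonal:
  fixes u :: "real ^ 'n"
  assumes u: "norm u = 1"
  shows "dir_deriv u (zonal \<alpha> u (Suc j)) x = (real j + 2 * \<alpha>) * zonal \<alpha> u j x"
proof (induction j rule: induct_nat_012)
  have uu: "u \<bullet> u = 1" using u by (simp add: dot_square_norm)
  { case 0
    show ?case
      by (simp add: zonal_abs dir_deriv_cmult[OF homogeneous_polys_inner] dir_deriv_inner uu)
  }
  note base = this
  { case 1
    show ?case
      unfolding dir_deriv_zonal_step base uu by (simp add: zonal_abs dir_deriv_const algebra_simps)
  }
  case (ge2 j)
  have Z: "real (j + 2) * zonal \<alpha> u (Suc (Suc j)) x =
     2 * (real (j + 2) + \<alpha> - 1) * ((u \<bullet> x) * zonal \<alpha> u (Suc j) x)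
      - (real (j + 2) + 2 * \<alpha> - 2) * ((norm x)\<^sup>2 * zonal \<alpha> u j x)"
    by simp
  have "real (Suc j + 2) * dir_deriv u (zonal \<alpha> u (Suc (Suc (Suc j)))) x =
     2 * (real (Suc j + 2) + \<alpha> - 1) * (zonal \<alpha> u (Suc (Suc j)) x
        + (u \<bullet> x) * ((real (Suc j) + 2 * \<alpha>) * zonal \<alpha> u (Suc j) x))
      - (real (Suc j + 2) + 2 * \<alpha> - 2) * (2 * (u \<bullet> x) * zonal \<alpha> u (Suc j) x
          + (norm x)\<^sup>2 * ((real j + 2 * \<alpha>) * zonal \<alpha> u j x))"
    unfolding dir_deriv_zonal_step[of u \<alpha> "Suc j"] uu ge2 by (simp del: zonal.simps)
  \<comment> \<open>The terms are regrouped so that the last bracket is the right-hand side of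
    \<open>Z\<close>, the recurrence one step lower.\<close>
  also have "\<dots> = 2 * (real (Suc j + 2) + \<alpha> - 1) * zonal \<alpha> u (Suc (Suc j)) x
     + (real (Suc j) + 2 * \<alpha>) * (2 * (real (j + 2) + \<alpha> - 1) * ((u \<bullet> x) * zonal \<alpha> u (Suc j) x)
      - (real (j + 2) + 2 * \<alpha> - 2) * ((norm x)\<^sup>2 * zonal \<alpha> u j x))"
    by (simp del: zonal.simps add: algebra_simps)
  also have "\<dots> = real (Suc j + 2) * ((real (Suc (Suc j)) + 2 * \<alpha>) * zonal \<alpha> u (Suc (Suc j)) x)"
    unfolding Z[symmetric] by (simp del: zonal.simps add: algebra_simps)
  finally show ?case by (simp del: zonal.simps)
qed

text \<open>For unit \<open>u\<close> and this \<open>\<alpha>\<close> the generating function is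
  the Newtonian potential \<open>norm (u - r x) powr (2 - n)\<close>, which explains why its
  coefficients in \<open>r\<close> are harmonic for exactly this parameter.\<close>

lemma zonal_harmonic:
  fixes u :: "real ^ 'n"
  assumes u: "norm u = 1" and \<alpha>: "\<alpha> = (real CARD('n) - 2) / 2"
  shows "zonal \<alpha> u j \<in> harmonic_polys j"
proof -
  have "laplacian (zonal \<alpha> u j) x = 0" for x
  proof (induction j rule: induct_nat_012)
    case 0
    show ?case by (simp add: zonal_abs laplacian_const)
  next
    case 1
    show ?case
      using laplacian_cmult[OF homogeneous_polys_inner[of u]] 
      by (simp add: zonal_abs laplacian_def[of "\<lambda>x. u \<bullet> x"] partial_deriv_inner partial_deriv_const)
  next
    case (ge2 j)
    \<comment> \<open>The value of \<open>\<alpha>\<close> enters here: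
      \<open>n = 2 * \<alpha> + 2\<close> makes the two contributions to the Laplacian
      cancel.\<close>
    have "2 * (real (j + 2) + \<alpha> - 1) * (2 * ((real j + 2 * \<alpha>) * z)) =
        (real (j + 2) + 2 * \<alpha> - 2) * ((2 * real CARD('n) + 4 * real j) * z)" for z
      by (simp add: \<alpha> field_simps)
    then show ?case
      unfolding laplacian_zonal_step ge2 dir_deriv_zonal[OF u] by simp
  qed
  then show ?thesis by (simp add: harmonic_polys_def zonal_homogeneous)
qed

text \<open>The three-term recurrence at 1 contains a subtraction and does not show the sign.
  Computing the derivative of the zonal polynomial at its pole twice, by Euler's identity and by
  \<open>dir_deriv_zonal\<close>, gives a two-term recurrence with positive factors.\<close>

lemma gegenbauer_at_1_pos:
  assumes "CARD('n::finite) \<ge> 3" and \<alpha>: "\<alpha> = (real CARD('n) - 2) / 2"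
  shows "poly (gegenbauer \<alpha> j) 1 > 0"
proof (induction j)
  case (Suc j)
  define u :: "real ^ 'n" where "u = axis undefined 1"
  have u: "norm u = 1" by (simp add: u_def)
  have "real (Suc j) * zonal \<alpha> u (Suc j) u = (real j + 2 * \<alpha>) * zonal \<alpha> u j u"
    using dir_deriv_self[OF zonal_homogeneous, of u] dir_deriv_zonal[OF u] by metis
  then have "real (Suc j) * poly (gegenbauer \<alpha> (Suc j)) 1 = (real j + 2 * \<alpha>) * poly (gegenbauer \<alpha> j) 1"
    using u by (simp add: zonal_sphere dot_square_norm del: zonal.simps gegenbauer.simps)
  moreover have "(real j + 2 * \<alpha>) * poly (gegenbauer \<alpha> j) 1 > 0"
    using Suc of_nat_mono[OF assms(1), where ?'a = real]
    by (intro mult_pos_pos) (simp_all add: \<alpha> field_simps)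
  ultimately show ?case by (metis of_nat_0_less_iff zero_less_Suc zero_less_mult_pos)
qed simp

subsection \<open>Integration over the sphere\<close>

lemma space_sphere_measure: "space (sphere_measure :: (real ^ 'n) measure) = sphere 0 1"
  by (simp add: sphere_measure_def space_scale_measure space_restrict_space)

lemma borel_measurable_sphere_measure:
  "f \<in> borel_measurable borel \<Longrightarrow> f \<in> borel_measurable (sphere_measure :: (real ^ 'n) measure)"
  by (simp add: sphere_measure_def measurable_restrict_space1 cong: measurable_cong_sets)

lemma emeasure_sphere_measure_sphere:
  "emeasure (sphere_measure :: (real ^ 'n) measure) (sphere 0 1) =
     of_nat CARD('n) * emeasure lborel (ball 0 1 - {0 :: real ^ 'n})"
proof -
  have "{r *\<^sub>R y | r y. 0 < r \<and> r < 1 \<and> y \<in> sphere 0 1} = ball 0 1 - {0 :: real ^ 'n}" (is "?L = ?R")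
  proof
    show "?R \<subseteq> ?L"
    proof
      fix x assume "x \<in> ?R"
      then have "x = norm x *\<^sub>R (x /\<^sub>R norm x)" "0 < norm x" "norm x < 1" "x /\<^sub>R norm x \<in> sphere 0 1"
        by auto
      then show "x \<in> ?L" by blast
    qed
  qed auto
  then show ?thesis by (subst emeasure_sphere_measure) auto
qed

lemma emeasure_unit_ball_minus_0:
  "emeasure lborel (ball 0 1 - {0 :: real ^ 'n}) = ennreal (unit_ball_vol (real CARD('n)))"
  by (subst emeasure_Diff) (auto simp: emeasure_ball)

lemma finite_measure_sphere_measure: "finite_measure (sphere_measure :: (real ^ 'n) measure)"
  by standard (simp add: space_sphere_measure emeasure_sphere_measure_sphere
      emeasure_unit_ball_minus_0 ennreal_mult_eq_top_iff)

lemma measure_sphere_measure_pos: "measure (sphere_measure :: (real ^ 'n) measure) (sphere 0 1) > 0"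
  by (simp add: measure_def emeasure_sphere_measure_sphere emeasure_unit_ball_minus_0 enn2real_mult
      unit_ball_vol_pos)

lemma continuous_bounded_on_unit_ball:
  fixes f :: "real ^ 'n \<Rightarrow> real"
  assumes "continuous_on UNIV f"
  obtains B where "B \<ge> 0" "\<And>x. norm x \<le> 1 \<Longrightarrow> \<bar>f x\<bar> \<le> B"
proof -
  have "bounded (f ` cball 0 1)"
    using assms by (intro compact_imp_bounded compact_continuous_image) (auto intro: continuous_on_subset)
  then obtain B where B: "\<forall>x\<in>cball 0 1. \<bar>f x\<bar> \<le> B" by (auto simp: bounded_iff)
  then have "\<bar>f x\<bar> \<le> B" if "norm x \<le> 1" for x using that by simp
  moreover from this[of 0] have "B \<ge> 0" by simp
  ultimately show ?thesis using that by blast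
qed

lemma integrable_sphere_measure:
  fixes f :: "real ^ 'n \<Rightarrow> real"
  assumes "continuous_on UNIV f"
  shows "integrable sphere_measure f"
proof -
  obtain B where "\<And>x. norm x \<le> 1 \<Longrightarrow> \<bar>f x\<bar> \<le> B"
    using continuous_bounded_on_unit_ball[OF assms] by blast
  then show ?thesis
    by (intro finite_measure.integrable_const_bound[OF finite_measure_sphere_measure, of _ B]
        borel_measurable_sphere_measure borel_measurable_continuous_onI assms AE_I2)
       (simp add: space_sphere_measure)
qed

lemma emeasure_lborel_cball_less_top: "emeasure lborel (cball c r) < top"
  using emeasure_lborel_cball_finite by simp

lemma borel_measurable_indicator_mult:
  "A \<in> sets borel \<Longrightarrow> f \<in> borel_measurable borel \<Longrightarrow>
    (\<lambda>x. indicator A x * f x :: real) \<in> borel_measurable borel"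
  by (intro borel_measurable_times borel_measurable_indicator)

text \<open>The cones defining the area measure fill the punctured open ball, while later integrals
  run over the compact closed ball; the origin and the unit sphere are null sets.\<close>

lemma AE_lborel_unit_ball:
  "AE x in lborel. (indicator (ball 0 1 - {0 :: real ^ 'n}) x :: real) = indicator (cball 0 1) x"
proof -
  have "sphere 0 1 \<in> null_sets (lborel :: (real ^ 'n) measure)"
    using negligible_sphere[of "0 :: real ^ 'n" 1]
    by (auto simp: null_sets_completion_iff negligible_iff_null_sets)
  from AE_not_in[OF this] AE_lborel_singleton[of "0 :: real ^ 'n"]
  show ?thesis by eventually_elim (auto simp: indicator_def)
qed

section \<open>Polar coordinates: sphere integrals as ball integrals\<close>

lemma integral_sphere_measure:
  fixes f :: "real ^ 'n \<Rightarrow> real"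
  assumes f: "f \<in> borel_measurable borel"
  shows "(LINT y|sphere_measure. f y) =
    real CARD('n) * (LINT x|lborel. indicator (cball 0 1) x * f (x /\<^sub>R norm x))"
proof -
  note f [measurable]
  let ?B = "ball 0 1 - {0 :: real ^ 'n}" and ?p = "\<lambda>x :: real ^ 'n. x /\<^sub>R norm x"
  define M where "M = distr (restrict_space lborel ?B) (restrict_space borel (sphere 0 1)) ?p"
  have "?p \<in> borel_measurable borel" by measurable
  then have p: "?p \<in> measurable (restrict_space lborel ?B) (restrict_space borel (sphere 0 1))"
    by (intro measurable_restrict_space2 measurable_restrict_space1)
       (auto simp: space_restrict_space)
  have fM: "f \<in> borel_measurable (restrict_space borel (sphere 0 1))"
    using f by (rule measurable_restrict_space1)
  have "(sphere_measure :: (real ^ 'n) measure) = scale_measure (of_nat CARD('n)) M"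
    by (simp add: sphere_measure_def M_def)
  also have "\<dots> = density M (\<lambda>_. ennreal (real CARD('n)))"
    by (rule measure_eqI) (auto simp: emeasure_density_const ennreal_of_nat_eq_real_of_nat)
  finally have "(LINT y|sphere_measure. f y) = (LINT y|density M (\<lambda>_. ennreal (real CARD('n))). f y)"
    by simp
  also have "\<dots> = real CARD('n) * (LINT y|M. f y)"
    using fM by (subst integral_density) (auto simp: M_def)
  also have "(LINT y|M. f y) = (LINT x|restrict_space lborel ?B. f (?p x))"
    unfolding M_def by (rule integral_distr[OF p fM])
  also have "\<dots> = (LINT x|lborel. indicator ?B x * f (?p x))"
    by (subst integral_restrict_space) auto
  also have "\<dots> = (LINT x|lborel. indicator (cball 0 1) x * f (?p x))"
  proof (rule integral_cong_AE)
    show "AE x in lborel. indicator ?B x * f (?p x) = indicator (cball 0 1) x * f (?p x)"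
      using AE_lborel_unit_ball by eventually_elim simp
  qed (auto intro!: borel_measurable_indicator_mult measurable_compose[OF _ f])
  finally show ?thesis .
qed

lemma integral_cball_scale:
  fixes G :: "real ^ 'n \<Rightarrow> real"
  assumes G[measurable]: "G \<in> borel_measurable borel" and hom: "\<And>t x. t > 0 \<Longrightarrow> G (t *\<^sub>R x) = G x" and t: "t > 0"
  shows "(LINT x|lborel. indicator (cball 0 t) x * G x) =
    t ^ CARD('n) * (LINT x|lborel. indicator (cball 0 1) x * G x)"
proof -
  have "(LINT x|lborel. indicator (cball 0 t) x * G x) =
    (LINT x|density (distr lborel borel (\<lambda>x :: real ^ 'n. 0 + t *\<^sub>R x)) (\<lambda>_. ennreal (\<bar>t\<bar> ^ DIM(real ^ 'n))).
       indicator (cball 0 t) x * G x)"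
    using lborel_affine[of t "0 :: real ^ 'n"] t by (simp add: ennreal_power)
  also have "\<dots> = t ^ CARD('n) * (LINT x|lborel. indicator (cball 0 t) (t *\<^sub>R x) * G (t *\<^sub>R x))"
  proof -
    have [measurable]: "(\<lambda>x :: real ^ 'n. indicator (cball 0 t) x * G x :: real) \<in> borel_measurable borel"
      by (intro borel_measurable_indicator_mult G) simp
    have "(\<lambda>x :: real ^ 'n. 0 + t *\<^sub>R x) \<in> borel_measurable borel" by measurable
    then show ?thesis
      using t by (subst integral_density) (auto simp: integral_distr)
  qed
  also have "(\<lambda>x :: real ^ 'n. indicator (cball 0 t) (t *\<^sub>R x) * G (t *\<^sub>R x)) = (\<lambda>x. indicator (cball 0 1) x * G x)"
    using t by (auto simp: fun_eq_iff indicator_def hom mult_le_cancel_left1)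
  finally show ?thesis .
qed

text \<open>Layer-cake integration: \<open>1 - norm x ^ Suc k\<close> is the integral of \<open>Suc k * t ^ k\<close> over \<open>{norm x..1}\<close>.\<close>

lemma integral_cball_radial:
  fixes G :: "real ^ 'n \<Rightarrow> real"
  assumes G[measurable]: "G \<in> borel_measurable borel" and hom: "\<And>t x. t > 0 \<Longrightarrow> G (t *\<^sub>R x) = G x"
    and B: "\<And>x. \<bar>G x\<bar> \<le> B"
  shows "real (CARD('n) + d) * (LINT x|lborel. indicator (cball 0 1) x * (norm x ^ d * G x)) =
    real CARD('n) * (LINT x|lborel. indicator (cball 0 1) x * G x)"
proof (cases d)
  case 0
  then show ?thesis by simp
next
  case (Suc k)
  define J where "J = (LINT x|lborel. indicator (cball 0 1) x * G x)"
  \<comment> \<open>For fixed \<open>x\<close> the integral over \<open>t\<close> gives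
    \<open>(1 - norm x ^ d) / d * G x\<close>. For fixed \<open>t\<close> in \<open>(0, 1]\<close>
    the support in \<open>x\<close> is the ball of radius \<open>t\<close>, and scaling gives
    \<open>t ^ (n + k) * J\<close>. Fubini equates the two iterated integrals.\<close>
  define f where "f x t = indicator (cball 0 1) x * indicator {norm x..1} t * (t ^ k * G x)"
    for x :: "real ^ 'n" and t :: real
  have fmeas: "case_prod f \<in> borel_measurable (lborel \<Otimes>\<^sub>M lborel)"
  proof -
    have "f x t = (if norm x \<le> 1 \<and> norm x \<le> t \<and> t \<le> 1 then t ^ k * G x else 0)" for x t
      by (auto simp: f_def indicator_def)
    then have "case_prod f = (\<lambda>p. if norm (fst p) \<le> 1 \<and> norm (fst p) \<le> snd p \<and> snd p \<le> 1
        then snd p ^ k * G (fst p) else 0)" by auto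
    also have "\<dots> \<in> borel_measurable (lborel \<Otimes>\<^sub>M lborel)" by measurable
    finally show ?thesis .
  qed
  have B0: "B \<ge> 0" using B[of 0] by linarith
  have fint: "integrable (lborel \<Otimes>\<^sub>M lborel) (case_prod f)"
  proof (rule integrableI_bounded_set[where A = "cball 0 1 \<times> {0..1}" and B = B])
    show "emeasure (lborel \<Otimes>\<^sub>M lborel) (cball (0 :: real ^ 'n) 1 \<times> {0..1 :: real}) < \<infinity>"
      by (subst lborel.emeasure_pair_measure_Times)
         (auto simp: ennreal_mult_less_top emeasure_lborel_cball_less_top)
    have "norm (f x t) \<le> B" for x t
    proof (cases "norm x \<le> 1 \<and> norm x \<le> t \<and> t \<le> 1")
      case True
      then have "0 \<le> t" by (meson norm_ge_zero order_trans)
      then have "t ^ k * \<bar>G x\<bar> \<le> 1 * B" using True B B0 by (intro mult_mono power_le_one) auto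
      with True \<open>0 \<le> t\<close> show ?thesis by (simp add: f_def abs_mult)
    qed (use B0 in \<open>auto simp: f_def indicator_def\<close>)
    then show "AE p in lborel \<Otimes>\<^sub>M lborel. p \<in> cball 0 1 \<times> {0..1} \<longrightarrow> norm (case_prod f p) \<le> B"
      by auto
    have "f x t = 0" if "\<not> (norm x \<le> 1 \<and> 0 \<le> t \<and> t \<le> 1)" for x t
      using that norm_ge_zero[of x] by (auto simp: f_def indicator_def simp del: norm_ge_zero)
    then show "AE p in lborel \<Otimes>\<^sub>M lborel. p \<notin> cball 0 1 \<times> {0..1} \<longrightarrow> case_prod f p = 0"
      by (intro AE_I2) (auto split: prod.split)
  qed (use fmeas in auto)
  have Gint: "integrable lborel (\<lambda>x. indicator (cball 0 1) x * G x)"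
    using integrableI_bounded_set_indicator[of "cball 0 1 :: (real ^ 'n) set" lborel G B] B
    by (auto simp: emeasure_lborel_cball_less_top)
  have Gint': "integrable lborel (\<lambda>x. indicator (cball 0 1) x * (norm x ^ d * G x))"
  proof -
    have "\<bar>norm x ^ d * G x\<bar> \<le> B" if "norm x \<le> 1" for x :: "real ^ 'n"
      using mult_mono[of "norm x ^ d" 1 "\<bar>G x\<bar>" B] B B0 that by (simp add: abs_mult power_le_one)
    then show ?thesis
      using integrableI_bounded_set_indicator[of "cball 0 1 :: (real ^ 'n) set" lborel "\<lambda>x. norm x ^ d * G x" B]
      by (auto simp: emeasure_lborel_cball_less_top)
  qed
  have x_int: "(LINT t|lborel. f x t) =
      (indicator (cball 0 1) x * G x - indicator (cball 0 1) x * (norm x ^ d * G x)) / real d" for x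
  proof (cases "norm x \<le> 1")
    case True
    have "(LINT t|lborel. f x t) = (LINT t|lborel. (t ^ k * indicator {norm x..1} t) * G x)"
      using True by (simp add: f_def mult_ac)
    also have "\<dots> = (1 - norm x ^ d) / real d * G x"
      using integral_power[OF True, of k] Suc by simp
    finally show ?thesis using True by (simp add: field_simps)
  qed (simp add: f_def)
  \<comment> \<open>The scaling lemma requires a positive radius; the excluded value
    \<open>t = 0\<close> is a null set.\<close>
  have t_int: "(LINT x|lborel. f x t) = (t ^ (CARD('n) + k) * indicator {0..1} t) * J" if "t \<noteq> 0" for t
  proof (cases "0 < t \<and> t \<le> 1")
    case True
    have "f x t = t ^ k * (indicator (cball 0 t) x * G x)" for x
      using True by (auto simp: f_def indicator_def)
    then have "(LINT x|lborel. f x t) = t ^ k * (LINT x|lborel. indicator (cball 0 t) x * G x)" by simp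
    also have "\<dots> = t ^ (CARD('n) + k) * J"
      using integral_cball_scale[OF G hom, of t] True by (simp add: J_def power_add)
    finally show ?thesis using True by simp
  next
    case False
    then have "f x t = 0" for x
      using that norm_ge_zero[of x] by (auto simp: f_def indicator_def simp del: norm_ge_zero)
    then show ?thesis using False that by auto
  qed
  have "(LINT t|lborel. (LINT x|lborel. f x t)) = (LINT t|lborel. (t ^ (CARD('n) + k) * indicator {0..1} t) * J)"
    using fmeas AE_lborel_singleton[of "0 :: real"]
    by (intro integral_cong_AE lborel.borel_measurable_lebesgue_integral)
       (auto simp: t_int elim: eventually_mono)
  also have "\<dots> = J / real (CARD('n) + d)"
    using integral_power[of 0 1 "CARD('n) + k"] Suc by simp
  also have "(LINT t|lborel. (LINT x|lborel. f x t)) = (LINT x|lborel. (LINT t|lborel. f x t))"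
    by (rule lborel_pair.Fubini_integral[OF fint])
  also have "\<dots> = (J - (LINT x|lborel. indicator (cball 0 1) x * (norm x ^ d * G x))) / real d"
    unfolding x_int J_def using Gint Gint' by simp
  finally show ?thesis
    using Suc unfolding J_def[symmetric] by (simp add: field_simps)
qed

text \<open>Writing \<open>H x = norm x ^ d * G x\<close> with \<open>G\<close> constant along rays,
  the radial integral of \<open>r ^ (n - 1 + d)\<close> over \<open>[0, 1]\<close> contributes
  \<open>1 / (n + d)\<close>.\<close>

lemma integral_sphere_homogeneous:
  fixes H :: "real ^ 'n \<Rightarrow> real"
  assumes H: "H \<in> homogeneous_polys d"
  shows "(LINT y|sphere_measure. H y) = real (CARD('n) + d) * (LINT x|lborel. indicator (cball 0 1) x * H x)"
proof -
  define G where "G x = H (x /\<^sub>R norm x)" for x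
  have cont: "continuous_on UNIV H" by (rule homogeneous_polys_continuous_on[OF H])
  then have Hm: "H \<in> borel_measurable borel" by (rule borel_measurable_continuous_onI)
  then have Gm: "G \<in> borel_measurable borel" unfolding G_def by measurable
  obtain B where "\<And>x. norm x \<le> 1 \<Longrightarrow> \<bar>H x\<bar> \<le> B"
    using continuous_bounded_on_unit_ball[OF cont] by blast
  then have GB: "\<bar>G x\<bar> \<le> B" for x by (cases "x = 0") (simp_all add: G_def)
  have hom: "G (t *\<^sub>R x) = G x" if "t > 0" for t x
    using that by (simp add: G_def field_simps)
  have HG: "H x = norm x ^ d * G x" for x
  proof (cases "x = 0")
    case True
    then show ?thesis using homogeneous_polys_scaleR[OF H, of 0 0] by (simp add: G_def)
  next
    case False
    then show ?thesis using homogeneous_polys_scaleR[OF H, of "norm x" "x /\<^sub>R norm x"] by (simp add: G_def)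
  qed
  show ?thesis
    unfolding integral_sphere_measure[OF Hm] G_def[symmetric]
    using integral_cball_radial[OF Gm hom GB, of d] unfolding HG[symmetric] by simp
qed

text \<open>By translation invariance the difference quotients of \<open>v\<close> integrate to zero.\<close>

lemma integral_directional_derivative_zero:
  fixes v D :: "real ^ 'n \<Rightarrow> real" and e :: "real ^ 'n"
  assumes der: "\<And>x. ((\<lambda>t. v (x + t *\<^sub>R e)) has_real_derivative D x) (at 0)"
    and v: "continuous_on UNIV v" and D: "continuous_on UNIV D"
    and supp: "\<And>x. norm x > 1 \<Longrightarrow> v x = 0" "\<And>x. norm x > 1 \<Longrightarrow> D x = 0"
    and e: "norm e \<le> 1"
  shows "(LINT x|lborel. D x) = 0"
proof -
  have vm[measurable]: "v \<in> borel_measurable borel" and Dm[measurable]: "D \<in> borel_measurable borel"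
    using v D by (auto intro: borel_measurable_continuous_onI)
  have "\<exists>C. \<forall>x. \<bar>g x\<bar> \<le> C" if g: "continuous_on UNIV g" "\<And>x. norm x > 1 \<Longrightarrow> g x = 0" for g :: "real ^ 'n \<Rightarrow> real"
    using continuous_bounded_on_unit_ball[OF g(1)] g(2) by (metis abs_zero not_le)
  from this[OF v supp(1)] this[OF D supp(2)] obtain Cv C where Cv: "\<And>x. \<bar>v x\<bar> \<le> Cv" and C: "\<And>x. \<bar>D x\<bar> \<le> C"
    by blast
  have C0: "C \<ge> 0" using C[of 0] by linarith
  have der': "((\<lambda>t. v (x + t *\<^sub>R e)) has_real_derivative D (x + s *\<^sub>R e)) (at s)" for x s
    using der[of "x + s *\<^sub>R e"] DERIV_shift[of "\<lambda>t. v (x + t *\<^sub>R e)" "D (x + s *\<^sub>R e)" 0 s]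
    by (simp add: algebra_simps)
  \<comment> \<open>The mean value theorem turns the bound on \<open>D\<close> into a bound on all
    difference quotients, as dominated convergence requires.\<close>
  have lip: "\<bar>v (x + h *\<^sub>R e) - v x\<bar> \<le> C * h" if h: "h > 0" for x h
  proof -
    obtain z where "v (x + h *\<^sub>R e) - v (x + 0 *\<^sub>R e) = (h - 0) * D (x + z *\<^sub>R e)"
      using MVT2[OF h, of "\<lambda>t. v (x + t *\<^sub>R e)" "\<lambda>s. D (x + s *\<^sub>R e)"] der' by blast
    then show ?thesis using C[of "x + z *\<^sub>R e"] h by (simp add: abs_mult mult.commute)
  qed
  define q where "q m x = (v (x + (1 / real (Suc m)) *\<^sub>R e) - v x) / (1 / real (Suc m))" for m x
  have vint: "integrable lborel v"
    by (rule integrableI_bounded_set[where A = "cball 0 1" and B = Cv])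
       (use Cv supp in \<open>auto simp: emeasure_lborel_cball_less_top\<close>)
  have vint': "integrable lborel (\<lambda>x. v (x + a))" "(LINT x|lborel. v (x + a)) = (LINT x|lborel. v x)" for a
  proof -
    have "integrable (distr lborel borel ((+) a)) v" unfolding lborel_distr_plus by (rule vint)
    then show "integrable lborel (\<lambda>x. v (x + a))" by (simp add: integrable_distr_eq add.commute)
    have "(LINT x|distr lborel borel ((+) a). v x) = (LINT x|lborel. v (a + x))"
      by (rule integral_distr) auto
    then show "(LINT x|lborel. v (x + a)) = (LINT x|lborel. v x)"
      by (simp add: lborel_distr_plus add.commute)
  qed
  have q0: "(LINT x|lborel. q m x) = 0" for m
    unfolding q_def using vint vint' by simp
  have "(\<lambda>m. (LINT x|lborel. q m x)) \<longlonglongrightarrow> (LINT x|lborel. D x)"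
  \<comment> \<open>The radius is 2 because \<open>v\<close> vanishes outside the unit ball and the
    increments have norm at most 1.\<close>
  proof (rule integral_dominated_convergence[where w = "\<lambda>x. indicator (cball 0 2) x * C"])
    show "integrable lborel (\<lambda>x :: real ^ 'n. indicator (cball 0 2) x * C)"
      by (intro integrable_mult_left integrable_real_indicator) (auto simp: emeasure_lborel_cball_less_top)
    have "(\<lambda>m. q m x) \<longlonglongrightarrow> D x" for x
    proof -
      have "((\<lambda>h. (v (x + h *\<^sub>R e) - v x) / h) \<longlongrightarrow> D x) (at 0)"
        using der[of x] by (simp add: DERIV_def)
      moreover have "filterlim (\<lambda>m. 1 / real (Suc m)) (at 0) sequentially"
        using LIMSEQ_inverse_real_of_nat by (auto simp: filterlim_at inverse_eq_divide)
      ultimately show ?thesis unfolding q_def by (rule filterlim_compose)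
    qed
    then show "AE x in lborel. (\<lambda>m. q m x) \<longlonglongrightarrow> D x" by simp
    have "norm (q m x) \<le> indicator (cball 0 2) x * C" for m x
    proof (cases "norm x \<le> 2")
      case True
      have "norm (q m x) = \<bar>v (x + (1 / real (Suc m)) *\<^sub>R e) - v x\<bar> / (1 / real (Suc m))"
        unfolding q_def real_norm_def abs_divide by simp
      also have "\<dots> \<le> C * (1 / real (Suc m)) / (1 / real (Suc m))"
        by (intro divide_right_mono lip) auto
      finally show ?thesis using True by simp
    next
      case False
      have "norm x \<le> norm (x + (1 / real (Suc m)) *\<^sub>R e) + norm ((1 / real (Suc m)) *\<^sub>R e)"
        by (metis add_diff_cancel_right' norm_triangle_ineq4)
      also have "norm ((1 / real (Suc m)) *\<^sub>R e) \<le> 1"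
        using e by (simp add: divide_le_eq)
      finally have "norm (x + (1 / real (Suc m)) *\<^sub>R e) > 1" using False by simp
      then have "q m x = 0" using False by (simp add: q_def supp)
      then show ?thesis using C0 by simp
    qed
    then show "AE x in lborel. norm (q m x) \<le> indicator (cball 0 2) x * C" for m by simp
  qed (simp_all add: q_def)
  then show ?thesis unfolding q0 using LIMSEQ_unique tendsto_const by blast
qed

text \<open>Squaring removes the kink of the positive part, so the cutoff used below has a
  continuous derivative across the unit sphere.\<close>

lemma DERIV_square_max_0: "((\<lambda>s :: real. (max 0 s)\<^sup>2) has_real_derivative 2 * max 0 s) (at s)"
  unfolding DERIV_def
proof (rule Lim_transform)
  show "((\<lambda>h. 2 * max 0 s) \<longlongrightarrow> 2 * max 0 s) (at (0 :: real))" by simp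
  have "norm ((max 0 (s + h))\<^sup>2 / h - (max 0 s)\<^sup>2 / h - 2 * max 0 s) \<le> \<bar>h\<bar>" if "h \<noteq> 0" for h
  proof -
    have "\<bar>(max 0 (s + h))\<^sup>2 - (max 0 s)\<^sup>2 - 2 * max 0 s * h\<bar> \<le> h\<^sup>2"
    proof (cases "s \<ge> 0")
      case s: True
      show ?thesis
      proof (cases "s + h \<ge> 0")
        case True
        with s show ?thesis by (simp add: max_def power2_eq_square algebra_simps)
      next
        case False
        \<comment> \<open>Here the error is \<open>s * (- s - 2 * h)\<close>, which is nonnegative
          and falls short of \<open>h\<^sup>2\<close> by exactly
          \<open>(s + h)\<^sup>2\<close>.\<close>
        then have "0 \<le> s * (- s - 2 * h)" "0 \<le> (s + h) * (s + h)"
          using s by (auto intro: mult_nonneg_nonneg)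
        then show ?thesis using s False by (simp add: max_def power2_eq_square algebra_simps abs_le_iff)
      qed
    next
      case s: False
      show ?thesis
      proof (cases "s + h \<ge> 0")
        case True
        then have "(s + h)\<^sup>2 \<le> h\<^sup>2" using s by (intro power_mono) auto
        then show ?thesis using s True by (simp add: max_def)
      qed (use s in \<open>simp add: max_def\<close>)
    qed
    then have "\<bar>(max 0 (s + h))\<^sup>2 - (max 0 s)\<^sup>2 - 2 * max 0 s * h\<bar> / \<bar>h\<bar> \<le> h\<^sup>2 / \<bar>h\<bar>"
      by (intro divide_right_mono) auto
    also have "h\<^sup>2 / \<bar>h\<bar> = \<bar>h\<bar>"
      by (metis abs_mult_self_eq nonzero_mult_div_cancel_right abs_eq_0 power2_eq_square that)
    finally show ?thesis using that
      by (simp add: abs_divide[symmetric] diff_divide_distrib)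
  qed
  then have "\<forall>\<^sub>F h in at 0. norm (((max 0 (s + h))\<^sup>2 - (max 0 s)\<^sup>2) / h - 2 * max 0 s) \<le> \<bar>h\<bar>"
    by (auto simp: eventually_at_filter diff_divide_distrib)
  moreover have "((\<lambda>h :: real. \<bar>h\<bar>) \<longlongrightarrow> 0) (at 0)" by (auto intro!: tendsto_eq_intros)
  ultimately show "((\<lambda>h. ((max 0 (s + h))\<^sup>2 - (max 0 s)\<^sup>2) / h - 2 * max 0 s) \<longlongrightarrow> 0) (at 0)"
    by (rule Lim_null_comparison)
qed

text \<open>
  Green's formula against the bump function \<open>(max 0 (1 - norm x ^ 2)) ^ 2\<close> shows that \<open>H\<close> and
  \<open>norm x ^ 2 * H\<close> have the same integral over the unit ball. Their integrals over the sphere also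
  agree, but the two ball integrals relate to these by different factors.
\<close>

lemma integral_sphere_harmonic_zero:
  fixes H :: "real ^ 'n \<Rightarrow> real"
  assumes H: "H \<in> harmonic_polys d" and d: "d > 0"
  shows "(LINT y|sphere_measure. H y) = 0"
proof -
  have hH: "H \<in> homogeneous_polys d" and L: "\<And>x. laplacian H x = 0"
    using H by (auto simp: harmonic_polys_def)
  define w where "w x = max 0 (1 - (norm x)\<^sup>2)" for x :: "real ^ 'n"
  \<comment> \<open>\<open>D i\<close> is the \<open>i\<close>-th partial derivative of
    \<open>(w x)\<^sup>2 * partial_deriv i H x\<close>, so the sum over \<open>i\<close> is the
    divergence of \<open>w\<^sup>2\<close> times the gradient of \<open>H\<close>. Harmonicity and
    Euler's identity reduce it to \<open>- 4 * d * w x * H x\<close>.\<close>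
  define D where "D i x = (w x)\<^sup>2 * partial_deriv i (partial_deriv i H) x - 4 * (x $ i * w x) * partial_deriv i H x"
    for i x
  note H1 = partial_deriv_homogeneous_polys[OF hH]
  note H2 = partial_deriv_homogeneous_polys[OF H1]
  have wc: "continuous_on UNIV w" unfolding w_def by (intro continuous_intros)
  have w0: "w x = 0" if "norm x > 1" for x
    using that one_less_power[of "norm x" 2] by (simp add: w_def)
  have Dc: "continuous_on UNIV (D i)" for i
    unfolding D_def by (intro continuous_intros wc homogeneous_polys_continuous_on[OF H1] homogeneous_polys_continuous_on[OF H2])
  have D0: "D i x = 0" if "norm x > 1" for i x using w0[OF that] by (simp add: D_def)
  have "(LINT x|lborel. D i x) = 0" for i
  proof (rule integral_directional_derivative_zero[where v = "\<lambda>x. (w x)\<^sup>2 * partial_deriv i H x" and e = "axis i 1"])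
    fix x :: "real ^ 'n"
    have 1: "((\<lambda>t. partial_deriv i H (x + t *\<^sub>R axis i 1)) has_real_derivative partial_deriv i (partial_deriv i H) x) (at 0)"
      by (rule homogeneous_polys_DERIV[OF H1])
    have "((\<lambda>t. (norm (x + t *\<^sub>R axis i 1))\<^sup>2) has_real_derivative 2 * x $ i) (at 0)"
      using homogeneous_polys_DERIV[OF homogeneous_polys_norm_square, of x i]
      by (simp add: partial_deriv_norm_square)
    then have "((\<lambda>t. 1 - (norm (x + t *\<^sub>R axis i 1))\<^sup>2) has_real_derivative - (2 * x $ i)) (at 0)"
      using DERIV_diff[OF DERIV_const] by fastforce
    then have 2: "((\<lambda>t. (w (x + t *\<^sub>R axis i 1))\<^sup>2) has_real_derivative 2 * w x * - (2 * x $ i)) (at 0)"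
      unfolding w_def by (rule DERIV_chain2[rotated]) (simp, rule DERIV_square_max_0)
    show "((\<lambda>t. (w (x + t *\<^sub>R axis i 1))\<^sup>2 * partial_deriv i H (x + t *\<^sub>R axis i 1)) has_real_derivative D i x) (at 0)"
      using DERIV_mult[OF 2 1] by (simp add: D_def algebra_simps)
  next
    show "continuous_on UNIV (\<lambda>x. (w x)\<^sup>2 * partial_deriv i H x)"
      by (intro continuous_intros wc homogeneous_polys_continuous_on[OF H1])
  qed (auto simp: Dc w0 D0)
  moreover have Dint: "integrable lborel (D i)" for i
  proof -
    obtain B where B: "\<And>x. norm x \<le> 1 \<Longrightarrow> \<bar>D i x\<bar> \<le> B"
      using continuous_bounded_on_unit_ball[OF Dc] by blast
    show ?thesis
      by (rule integrableI_bounded_set[where A = "cball 0 1" and B = B])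
         (use B Dc in \<open>auto simp: D0 emeasure_lborel_cball_less_top intro: borel_measurable_continuous_onI\<close>)
  qed
  ultimately have "(LINT x|lborel. (\<Sum>i\<in>UNIV. D i x)) = 0" by simp
  moreover have "(\<Sum>i\<in>UNIV. D i x) = - 4 * real d * (indicator (cball 0 1) x * H x - indicator (cball 0 1) x * ((norm x)\<^sup>2 * H x))" for x
  proof -
    have "(\<Sum>i\<in>UNIV. D i x) = (w x)\<^sup>2 * laplacian H x - 4 * w x * (\<Sum>i\<in>UNIV. x $ i * partial_deriv i H x)"
      by (simp add: D_def laplacian_def sum_subtractf sum_distrib_left mult_ac)
    also have "\<dots> = - 4 * real d * (w x * H x)"
      by (simp add: L euler_homogeneous[OF hH])
    also have "w x = indicator (cball 0 1) x * (1 - (norm x)\<^sup>2)"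
      using w0[of x] power_le_one[of "norm x" 2] by (auto simp: w_def indicator_def)
    finally show ?thesis by (simp add: algebra_simps)
  qed
  moreover have int: "integrable lborel (\<lambda>x. indicator (cball 0 1) x * F x)" if "F \<in> homogeneous_polys e" for F :: "real ^ 'n \<Rightarrow> real" and e
    using borel_integrable_compact[of "cball 0 1" F] homogeneous_polys_continuous_on[OF that]
    by (simp add: indicator_def if_distrib cong: if_cong)
  note nH = homogeneous_polys_mult[OF homogeneous_polys_norm_square hH]
  \<comment> \<open>For \<open>d = 0\<close> the integrated identity is vacuous;
    \<open>d > 0\<close> allows cancelling \<open>- 4 * d\<close>.\<close>
  ultimately have "(LINT x|lborel. indicator (cball 0 1) x * H x) = (LINT x|lborel. indicator (cball 0 1) x * ((norm x)\<^sup>2 * H x))"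
    using d int[OF hH] int[OF nH] by simp
  moreover have "(LINT y|sphere_measure. (norm y)\<^sup>2 * H y) = (LINT y|sphere_measure. H y)"
    by (rule Bochner_Integration.integral_cong) (auto simp: space_sphere_measure)
  ultimately have "real (CARD('n) + d) * (LINT x|lborel. indicator (cball 0 1) x * H x) =
     real (CARD('n) + (2 + d)) * (LINT x|lborel. indicator (cball 0 1) x * H x)"
    using integral_sphere_homogeneous[OF hH] integral_sphere_homogeneous[OF nH] by simp
  then show ?thesis using integral_sphere_homogeneous[OF hH] by (simp add: algebra_simps)
qed

subsection \<open>Gegenbauer polynomials as reproducing kernels\<close>

lemma continuous_on_poly_inner_mult:
  assumes "F \<in> homogeneous_polys d"
  shows "continuous_on UNIV (\<lambda>y. poly p (u \<bullet> y) * F y)"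
  by (intro continuous_intros homogeneous_polys_continuous_on[OF assms])

text \<open>On the sphere the factor \<open>(norm y)\<^sup>2\<close> in \<open>raise_part\<close> is
  1, so solving its definition for \<open>(u \<bullet> y) * F y\<close> leaves two harmonic
  summands.\<close>

lemma integral_inner_mult_harmonic:
  fixes u :: "real ^ 'n"
  assumes n: "CARD('n) \<ge> 3" and F: "F \<in> harmonic_polys d"
  shows "(LINT y|sphere_measure. poly p (u \<bullet> y) * ((u \<bullet> y) * F y)) =
    (LINT y|sphere_measure. poly p (u \<bullet> y) * raise_part u d F y)
    + (LINT y|sphere_measure. poly p (u \<bullet> y) * (1 / (real CARD('n) + 2 * real d - 2) * dir_deriv u F y))"
proof -
  let ?D = "\<lambda>y. 1 / (real CARD('n) + 2 * real d - 2) * dir_deriv u F y"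
  have "?D \<in> harmonic_polys (d - 1)" by (intro harmonic_cmult harmonic_dir_deriv F)
  then have 1: "raise_part u d F \<in> homogeneous_polys (Suc d)" and 2: "?D \<in> homogeneous_polys (d - 1)"
    using harmonic_raise_part[OF n F] by (simp_all add: harmonic_polys_def)
  have "(LINT y|sphere_measure. poly p (u \<bullet> y) * ((u \<bullet> y) * F y)) =
    (LINT y|sphere_measure. poly p (u \<bullet> y) * raise_part u d F y + poly p (u \<bullet> y) * ?D y)"
    by (rule Bochner_Integration.integral_cong)
       (auto simp: space_sphere_measure raise_part_def algebra_simps)
  also have "\<dots> = (LINT y|sphere_measure. poly p (u \<bullet> y) * raise_part u d F y)
    + (LINT y|sphere_measure. poly p (u \<bullet> y) * ?D y)"
    by (intro Bochner_Integration.integral_add integrable_sphere_measure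
        continuous_on_poly_inner_mult[OF 1] continuous_on_poly_inner_mult[OF 2])
  finally show ?thesis .
qed

text \<open>\<open>d\<close> and \<open>F\<close> are generalised because the recurrence replaces
  \<open>F\<close> by its raised part and its derivative, in degrees \<open>d + 1\<close> and
  \<open>d - 1\<close>.\<close>

lemma integral_gegenbauer_harmonic:
  fixes u :: "real ^ 'n"
  assumes n: "CARD('n) \<ge> 3" and \<alpha>: "\<alpha> = (real CARD('n) - 2) / 2" and u: "norm u = 1"
    and "F \<in> harmonic_polys d"
  shows "(LINT y|sphere_measure. poly (gegenbauer \<alpha> j) (u \<bullet> y) * F y) =
    (if j = d then measure (sphere_measure :: (real ^ 'n) measure) (sphere 0 1) * \<alpha> / (\<alpha> + real d) * F u else 0)"
  using assms(4)
proof (induction j arbitrary: d F rule: induct_nat_012)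
  have nn: "real CARD('n) = 2 * \<alpha> + 2" and \<alpha>0: "\<alpha> > 0" using n by (simp_all add: \<alpha> field_simps)
  let ?D = "\<lambda>d F y. 1 / (real CARD('n) + 2 * real d - 2) * dir_deriv u F y"
  let ?\<mu> = "measure (sphere_measure :: (real ^ 'n) measure) (sphere 0 1)"
  \<comment> \<open>In terms of \<open>\<alpha>\<close> the denominator \<open>n + 2 * d - 2\<close>
    is \<open>2 * (\<alpha> + d)\<close>. The two weights add up to 1 because
    \<open>u \<bullet> u = 1\<close>.\<close>
  have Du: "?D d F u = real d / (2 * (\<alpha> + real d)) * F u"
    and Ru: "raise_part u d F u = (2 * \<alpha> + real d) / (2 * (\<alpha> + real d)) * F u"
    and R: "raise_part u d F \<in> harmonic_polys (Suc d)" and D: "?D d F \<in> harmonic_polys (d - 1)"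
    if "F \<in> harmonic_polys d" for d F
  proof -
    have F: "F \<in> homogeneous_polys d" using that by (simp add: harmonic_polys_def)
    show D: "?D d F u = real d / (2 * (\<alpha> + real d)) * F u"
      using \<alpha>0 by (simp add: nn dir_deriv_self[OF F] field_simps)
    show "raise_part u d F u = (2 * \<alpha> + real d) / (2 * (\<alpha> + real d)) * F u"
      unfolding raise_part_def D using u \<alpha>0 by (simp add: dot_square_norm field_simps)
    show "raise_part u d F \<in> harmonic_polys (Suc d)" "?D d F \<in> harmonic_polys (d - 1)"
      by (intro harmonic_raise_part harmonic_cmult harmonic_dir_deriv n that)+
  qed
  { case (0 d F)
    show ?case
    proof (cases d)
      case 0
      with \<open>F \<in> harmonic_polys d\<close> obtain r where "F = (\<lambda>x. r)"
        by (auto simp: harmonic_polys_def homogeneous_polys_def)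
      then show ?thesis using 0 \<alpha>0 by (simp add: space_sphere_measure mult.commute)
    qed (use integral_sphere_harmonic_zero[OF 0] in auto)
  }
  note base = this
  { case (1 d F)
    have "(LINT y|sphere_measure. poly (gegenbauer \<alpha> (Suc 0)) (u \<bullet> y) * F y) =
      2 * \<alpha> * (LINT y|sphere_measure. poly (gegenbauer \<alpha> 0) (u \<bullet> y) * ((u \<bullet> y) * F y))"
      by (simp add: mult_ac flip: integral_mult_right_zero)
    \<comment> \<open>The raised part has positive degree and integrates to zero. The test
      \<open>d - 1 = 0\<close> also succeeds for \<open>d = 0\<close>, where the factor
      \<open>d\<close> in \<open>Du\<close> removes the term.\<close>
    also have "\<dots> = 2 * \<alpha> * (if d - 1 = 0 then ?\<mu> * ?D d F u else 0)"
      unfolding integral_inner_mult_harmonic[OF n 1] base[OF R[OF 1]] base[OF D[OF 1]] using \<alpha>0 by simp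
    also have "\<dots> = (if Suc 0 = d then ?\<mu> * \<alpha> / (\<alpha> + real d) * F u else 0)"
      unfolding Du[OF 1] using \<alpha>0 by (cases "d = 0") (auto simp: field_simps)
    finally show ?case .
  next
    case (ge2 j d F)
    let ?I = "\<lambda>j F. LINT y|sphere_measure. poly (gegenbauer \<alpha> j) (u \<bullet> y) * F y"
    have F: "F \<in> homogeneous_polys d" using ge2 by (simp add: harmonic_polys_def)
    have uF: "(\<lambda>y. (u \<bullet> y) * F y) \<in> homogeneous_polys (Suc 0 + d)"
      by (rule homogeneous_polys_mult[OF homogeneous_polys_inner F])
    have "?I (Suc (Suc j)) F = (LINT y|sphere_measure. 1 / real (j + 2) *
        (2 * (real (j + 2) + \<alpha> - 1) * (poly (gegenbauer \<alpha> (Suc j)) (u \<bullet> y) * ((u \<bullet> y) * F y))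
         - (real (j + 2) + 2 * \<alpha> - 2) * (poly (gegenbauer \<alpha> j) (u \<bullet> y) * F y)))"
      by (simp add: algebra_simps)
    also have "\<dots> = 1 / real (j + 2) *
        (2 * (real (j + 2) + \<alpha> - 1) * ?I (Suc j) (\<lambda>y. (u \<bullet> y) * F y)
         - (real (j + 2) + 2 * \<alpha> - 2) * ?I j F)"
      using integrable_sphere_measure[OF continuous_on_poly_inner_mult[OF uF]]
        integrable_sphere_measure[OF continuous_on_poly_inner_mult[OF F]]
      by (subst integral_mult_right_zero, subst Bochner_Integration.integral_diff) auto
    also have "\<dots> = (if Suc (Suc j) = d then ?\<mu> * \<alpha> / (\<alpha> + real d) * F u else 0)"
      unfolding integral_inner_mult_harmonic[OF n ge2(3)] ge2.IH(1)[OF ge2(3)]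
        ge2.IH(2)[OF R[OF ge2(3)]] ge2.IH(2)[OF D[OF ge2(3)]] Du[OF ge2(3)] Ru[OF ge2(3)]
    proof -
      \<comment> \<open>For \<open>d = j + 2\<close> only the derivative part contributes. For
        \<open>d = j\<close> the raised part and the subtracted recurrence term cancel; for all
        other \<open>d\<close> every term is zero.\<close>
      consider "d = Suc (Suc j)" | "d = j" | "d \<noteq> Suc (Suc j)" "d \<noteq> j" by blast
      then show "1 / real (j + 2) * (2 * (real (j + 2) + \<alpha> - 1) *
          ((if Suc j = Suc d then ?\<mu> * \<alpha> / (\<alpha> + real (Suc d)) * ((2 * \<alpha> + real d) / (2 * (\<alpha> + real d)) * F u) else 0)
           + (if Suc j = d - 1 then ?\<mu> * \<alpha> / (\<alpha> + real (d - 1)) * (real d / (2 * (\<alpha> + real d)) * F u) else 0))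
         - (real (j + 2) + 2 * \<alpha> - 2) * (if j = d then ?\<mu> * \<alpha> / (\<alpha> + real d) * F u else 0))
        = (if Suc (Suc j) = d then ?\<mu> * \<alpha> / (\<alpha> + real d) * F u else 0)"
      proof cases
        case 1
        define A where "A = \<alpha> + real j + 1"
        have "A > 0" using \<alpha>0 by (simp add: A_def)
        have e: "real (j + 2) + \<alpha> - 1 = A" "\<alpha> + real (d - 1) = A" "\<alpha> + real d = A + 1" "real d = real (j + 2)"
          using 1 by (simp_all add: A_def)
        show ?thesis unfolding e(1-3) unfolding e(4) using 1 \<open>A > 0\<close> by simp (simp add: field_simps)
      next
        case 2
        define A B where "A = \<alpha> + real j" and "B = \<alpha> + real j + 1"
        have pos: "A > 0" "B > 0" using \<alpha>0 by (simp_all add: A_def B_def)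
        have e: "real (j + 2) + \<alpha> - 1 = B" "\<alpha> + real (Suc d) = B" "\<alpha> + real d = A"
          "real (j + 2) + 2 * \<alpha> - 2 = 2 * \<alpha> + real d"
          using 2 by (simp_all add: A_def B_def)
        show ?thesis unfolding e using 2 pos by simp
      qed auto
    qed
    finally show ?case .
  }
qed

text \<open>Makes the basis coefficients of a zonal polynomial integrable as functions of its pole.
  No continuity of \<open>\<phi>\<close> is assumed, so the dependence on \<open>u\<close> is
  extracted from the recurrence, which is polynomial in \<open>u\<close>. The factor
  \<open>q\<close> absorbs the coordinates and powers of \<open>norm y\<close> produced on the
  way.\<close>

lemma zonal_functional_continuous:
  fixes \<phi> :: "(real ^ 'n \<Rightarrow> real) \<Rightarrow> real"
  assumes add: "\<And>f g. \<phi> (\<lambda>y. f y + g y) = \<phi> f + \<phi> g"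
    and scale: "\<And>r f. \<phi> (\<lambda>y. r * f y) = r * \<phi> f"
  shows "continuous_on UNIV (\<lambda>u. \<phi> (\<lambda>y. zonal \<alpha> u j y * q y))"
proof (induction j arbitrary: q rule: induct_nat_012)
  have sum: "\<phi> (\<lambda>y. \<Sum>i\<in>I. f i y) = (\<Sum>i\<in>I. \<phi> (f i))" for I :: "'n set" and f
    using scale[of 0] by (induction I rule: infinite_finite_induct) (auto simp: add)
  have diff: "\<phi> (\<lambda>y. f y - g y) = \<phi> f - \<phi> g" for f g
    using add[of f "\<lambda>y. (-1) * g y"] scale[of "-1" g] by simp
  have inner: "\<phi> (\<lambda>y. Z y * ((u \<bullet> y) * q y)) = (\<Sum>i\<in>UNIV. u $ i * \<phi> (\<lambda>y. Z y * (y $ i * q y)))" for u Z q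
  proof -
    have "\<phi> (\<lambda>y. Z y * ((u \<bullet> y) * q y)) = \<phi> (\<lambda>y. \<Sum>i\<in>UNIV. u $ i * (Z y * (y $ i * q y)))"
      by (simp add: inner_vec_def sum_distrib_left sum_distrib_right mult_ac)
    then show ?thesis by (simp only: sum scale)
  qed
  { case 0
    show ?case by simp
  next
    case 1
    have "\<phi> (\<lambda>y. zonal \<alpha> u (Suc 0) y * q y) = 2 * \<alpha> * (\<Sum>i\<in>UNIV. u $ i * \<phi> (\<lambda>y. 1 * (y $ i * q y)))" for u
    proof -
      have "(\<lambda>y. zonal \<alpha> u (Suc 0) y * q y) = (\<lambda>y. 2 * \<alpha> * (1 * ((u \<bullet> y) * q y)))"
        by (simp add: mult_ac)
      then show ?thesis by (simp only: scale[of "2 * \<alpha>"] inner)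
    qed
    then show ?case by (simp only:) (intro continuous_intros)
  next
    case (ge2 j)
    have "\<phi> (\<lambda>y. zonal \<alpha> u (Suc (Suc j)) y * q y) = 1 / real (j + 2) *
       (2 * (real (j + 2) + \<alpha> - 1) * (\<Sum>i\<in>UNIV. u $ i * \<phi> (\<lambda>y. zonal \<alpha> u (Suc j) y * (y $ i * q y)))
      - (real (j + 2) + 2 * \<alpha> - 2) * \<phi> (\<lambda>y. zonal \<alpha> u j y * ((norm y)\<^sup>2 * q y)))" for u
    proof -
      have "(\<lambda>y. zonal \<alpha> u (Suc (Suc j)) y * q y) = (\<lambda>y. 1 / real (j + 2) *
         (2 * (real (j + 2) + \<alpha> - 1) * (zonal \<alpha> u (Suc j) y * ((u \<bullet> y) * q y))
          - (real (j + 2) + 2 * \<alpha> - 2) * (zonal \<alpha> u j y * ((norm y)\<^sup>2 * q y))))"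
        by (simp add: algebra_simps)
      then show ?thesis
        by (simp only: scale[of "1 / real (j + 2)"] diff scale[of "2 * (real (j + 2) + \<alpha> - 1)"]
            scale[of "real (j + 2) + 2 * \<alpha> - 2"] inner)
    qed
    then show ?case by (simp only:) (intro continuous_intros ge2)
  }
qed

lemma sum_fun_apply: "(\<Sum>a\<in>A. f a) x = (\<Sum>a\<in>A. f a x)"
  by (induction A rule: infinite_finite_induct) auto

lemma homogeneous_polys_eqI:
  fixes F :: "real ^ 'n \<Rightarrow> real"
  assumes F: "F \<in> homogeneous_polys d" and G: "G \<in> homogeneous_polys d"
    and eq: "\<And>u. norm u = 1 \<Longrightarrow> F u = G u"
  shows "F = G"
proof
  fix x :: "real ^ 'n"
  obtain u where u: "norm u = 1" "x = norm x *\<^sub>R u"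
  proof (cases "x = 0")
    case True
    then show ?thesis using that[of "axis undefined 1"] by simp
  next
    case False
    then show ?thesis using that[of "x /\<^sub>R norm x"] by simp
  qed
  then show "F x = G x"
    using homogeneous_polys_scaleR[OF F, of "norm x" u] homogeneous_polys_scaleR[OF G, of "norm x" u] eq by metis
qed

text \<open>
  The zonal polynomials reproduce \<open>H\<^sub>d\<close> up to a factor \<open>\<gamma>\<close>. Expanding the kernel in a basis of \<open>H\<^sub>d\<close>
  and integrating it over the diagonal gives \<open>\<gamma> * dim H\<^sub>d\<close>.
\<close>

lemma dim_harmonic_polys:
  fixes d :: nat
  assumes n: "CARD('n) \<ge> 3" and \<alpha>: "\<alpha> = (real CARD('n) - 2) / 2"
  shows "real (vector_space.dim fun_scale (harmonic_polys d :: (real ^ 'n \<Rightarrow> real) set)) * \<alpha> =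
    (\<alpha> + real d) * poly (gegenbauer \<alpha> d) 1"
proof -
  interpret V: vector_space "fun_scale :: real \<Rightarrow> (real ^ 'n \<Rightarrow> real) \<Rightarrow> _"
    by (rule vector_space_fun_scale)
  let ?H = "harmonic_polys d :: (real ^ 'n \<Rightarrow> real) set"
  let ?\<mu> = "measure (sphere_measure :: (real ^ 'n) measure) (sphere 0 1)"
  obtain B where BH: "B \<subseteq> ?H" and ind: "V.independent B" and sp: "?H \<subseteq> V.span B" and card: "card B = V.dim ?H"
    using V.basis_exists by blast
  define m where "m a = (\<lambda>x :: real ^ 'n. \<Prod>i\<in>UNIV. (x $ i) ^ a i)" for a
  have "?H \<subseteq> V.span (m ` {a. (\<Sum>i\<in>UNIV. a i) = d})"
  proof
    fix F assume "F \<in> ?H"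
    then obtain c where "F = (\<lambda>x. \<Sum>a \<in> {a. (\<Sum>i\<in>UNIV. a i) = d}. c a * (\<Prod>i\<in>UNIV. (x $ i) ^ a i))"
      by (auto simp: harmonic_polys_def homogeneous_polys_def)
    then have "F = (\<Sum>a \<in> {a. (\<Sum>i\<in>UNIV. a i) = d}. fun_scale (c a) (m a))"
      by (simp add: fun_eq_iff sum_fun_apply fun_scale_def m_def)
    also have "\<dots> \<in> V.span (m ` {a. (\<Sum>i\<in>UNIV. a i) = d})"
      by (intro V.span_sum V.span_scale V.span_base imageI)
    finally show "F \<in> V.span (m ` {a. (\<Sum>i\<in>UNIV. a i) = d})" .
  qed
  then have fin: "finite B"
    using V.independent_span_bound[OF finite_imageI[OF finite_multiindices] ind] BH by blast
  \<comment> \<open>Coefficients are taken in a basis of the whole function space, so that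
    \<open>\<phi> b\<close> is linear on all functions; the continuity lemma also applies it to
    products lying outside \<open>H_d\<close>.\<close>
  define \<phi> where "\<phi> b f = V.representation (V.extend_basis B) f b" for b f
  define \<kappa> where "\<kappa> b u = \<phi> b (zonal \<alpha> u d)" for b u
  note E = V.independent_extend_basis[OF ind] V.span_extend_basis[OF ind]
  have \<phi>_add: "\<phi> b (\<lambda>y. f y + g y) = \<phi> b f + \<phi> b g" for b f g
    using V.representation_add[OF E(1), of g f] E(2) by (simp add: \<phi>_def plus_fun_def)
  have \<phi>_scale: "\<phi> b (\<lambda>y. r * f y) = r * \<phi> b f" for b r f
    using V.representation_scale[OF E(1), of f r] E(2) by (simp add: \<phi>_def fun_scale_def)
  have \<kappa>_cont: "continuous_on UNIV (\<kappa> b)" for b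
    using zonal_functional_continuous[of "\<phi> b" \<alpha> d "\<lambda>_. 1", OF \<phi>_add \<phi>_scale] by (simp add: \<kappa>_def[abs_def])
  have expand: "zonal \<alpha> u d y = (\<Sum>b\<in>B. \<kappa> b u * b y)" if "norm u = 1" for u y
  proof -
    have Z: "zonal \<alpha> u d \<in> V.span B" using zonal_harmonic[OF that \<alpha>] sp by blast
    have "\<phi> b (zonal \<alpha> u d) = V.representation B (zonal \<alpha> u d) b" for b
      unfolding \<phi>_def V.representation_extend[OF E(1) Z V.extend_basis_superset[OF ind]] ..
    then have "zonal \<alpha> u d = (\<Sum>b\<in>B. fun_scale (\<kappa> b u) b)"
      using V.sum_representation_eq[OF ind Z fin] by (simp add: \<kappa>_def)
    from arg_cong[OF this, of "\<lambda>f. f y"] show ?thesis by (simp add: sum_fun_apply fun_scale_def)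
  qed
  define \<gamma> where "\<gamma> = ?\<mu> * \<alpha> / (\<alpha> + real d)"
  define M where "M b b' = (LINT y|sphere_measure. \<kappa> b y * b' y)" for b b'
  have hB: "b \<in> homogeneous_polys d" if "b \<in> B" for b using BH that by (auto simp: harmonic_polys_def)
  have int: "integrable sphere_measure (\<lambda>y. \<kappa> b y * b' y)" if "b' \<in> B" for b b'
    by (intro integrable_sphere_measure continuous_intros \<kappa>_cont homogeneous_polys_continuous_on[OF hB[OF that]])
  have M: "M b b = \<gamma>" if b': "b \<in> B" for b
  proof -
    have "(\<lambda>x. \<gamma> * b x) = (\<lambda>x. \<Sum>c\<in>B. M c b * c x)"
    proof (rule homogeneous_polys_eqI[of _ d])
      fix u :: "real ^ 'n" assume u: "norm u = 1"
      have "\<gamma> * b u = (LINT y|sphere_measure. poly (gegenbauer \<alpha> d) (u \<bullet> y) * b y)"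
        using BH b' by (subst integral_gegenbauer_harmonic[OF n \<alpha> u, of b d]) (auto simp: \<gamma>_def)
      also have "\<dots> = (LINT y|sphere_measure. (\<Sum>c\<in>B. (\<kappa> c y * b y) * c u))"
      proof (rule Bochner_Integration.integral_cong)
        fix y :: "real ^ 'n" assume "y \<in> space sphere_measure"
        then have y: "norm y = 1" by (simp add: space_sphere_measure)
        \<comment> \<open>By symmetry of the inner product the kernel is expanded with pole
          \<open>y\<close>: the coefficients carry the integration variable, and \<open>u\<close>
          enters only through basis functions, whose independence then determines
          \<open>M\<close>.\<close>
        have "poly (gegenbauer \<alpha> d) (u \<bullet> y) = (\<Sum>c\<in>B. \<kappa> c y * c u)"
          using expand[OF y, of u] zonal_sphere[OF u, of \<alpha> y d] by (simp add: inner_commute)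
        then show "poly (gegenbauer \<alpha> d) (u \<bullet> y) * b y = (\<Sum>c\<in>B. (\<kappa> c y * b y) * c u)"
          by (simp add: sum_distrib_left mult_ac)
      qed simp
      also have "\<dots> = (\<Sum>c\<in>B. M c b * c u)"
        using int[OF b'] by (subst Bochner_Integration.integral_sum) (auto simp: M_def)
      finally show "\<gamma> * b u = (\<Sum>c\<in>B. M c b * c u)" .
    qed (intro homogeneous_polys_cmult homogeneous_polys_sum hB b'; assumption)+
    then have "(\<Sum>c\<in>B. fun_scale (M c b - (if c = b then \<gamma> else 0)) c) = 0"
    proof -
      have "(\<Sum>c\<in>B. (M c b - (if c = b then \<gamma> else 0)) * c x) =
          (\<Sum>c\<in>B. M c b * c x) - (\<Sum>c\<in>B. if c = b then \<gamma> * b x else 0)" for x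
        unfolding sum_subtractf[symmetric] by (rule sum.cong) (auto simp: left_diff_distrib)
      moreover have "\<gamma> * b x = (\<Sum>c\<in>B. M c b * c x)" for x
        using \<open>(\<lambda>x. \<gamma> * b x) = _\<close> by meson
      ultimately show ?thesis
        using b' fin by (intro ext) (simp add: sum_fun_apply fun_scale_def)
    qed
    from V.independentD[OF ind fin order_refl this b'] show ?thesis by simp
  qed
  have "?\<mu> * poly (gegenbauer \<alpha> d) 1 = (LINT y|(sphere_measure :: (real ^ 'n) measure). poly (gegenbauer \<alpha> d) 1)"
    by (simp add: space_sphere_measure)
  also have "\<dots> = (LINT y|sphere_measure. (\<Sum>b\<in>B. \<kappa> b y * b y))"
  proof (rule Bochner_Integration.integral_cong)
    fix y :: "real ^ 'n" assume "y \<in> space sphere_measure"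
    then have y: "norm y = 1" by (simp add: space_sphere_measure)
    show "poly (gegenbauer \<alpha> d) 1 = (\<Sum>b\<in>B. \<kappa> b y * b y)"
      using expand[OF y, of y] zonal_sphere[OF y, of \<alpha> y d] y by (simp add: dot_square_norm)
  qed simp
  also have "\<dots> = (\<Sum>b\<in>B. M b b)"
    using int by (subst Bochner_Integration.integral_sum) (auto simp: M_def)
  also have "\<dots> = real (V.dim ?H) * \<gamma>" using M card by simp
  finally have "?\<mu> * poly (gegenbauer \<alpha> d) 1 = ?\<mu> * (real (V.dim ?H) * (\<alpha> / (\<alpha> + real d)))"
    by (simp add: \<gamma>_def)
  then have "poly (gegenbauer \<alpha> d) 1 = real (V.dim ?H) * (\<alpha> / (\<alpha> + real d))"
    by (rule mult_left_cancel[THEN iffD1, rotated]) (use measure_sphere_measure_pos[where 'n = 'n] in simp)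
  moreover have "\<alpha> + real d > 0" using n by (simp add: \<alpha> add_pos_nonneg)
  ultimately show ?thesis by (simp add: field_simps)
qed

section \<open>The normalised kernel and its action on harmonic expansions\<close>

lemma integral_normalized_gegenbauer_harmonic:
  fixes u :: "real ^ 'n"
  assumes n: "CARD('n) \<ge> 3" and u: "norm u = 1" and F: "F \<in> harmonic_polys d"
  shows "(LINT y|sphere_measure. poly (normalized_gegenbauer TYPE('n) j) (u \<bullet> y) * F y) = (if j = d then F u else 0)"
proof -
  define \<alpha> where \<alpha>: "\<alpha> = (real CARD('n) - 2) / 2"
  let ?\<mu> = "measure (sphere_measure :: (real ^ 'n) measure) (sphere 0 1)"
  let ?N = "\<lambda>j. real (vector_space.dim fun_scale (harmonic_polys j :: (real ^ 'n \<Rightarrow> real) set))"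
  have pos: "?\<mu> > 0" "poly (gegenbauer \<alpha> j) 1 > 0" "\<alpha> > 0"
    using measure_sphere_measure_pos gegenbauer_at_1_pos[OF n \<alpha>] n by (auto simp: \<alpha>)
  have "(LINT y|sphere_measure. poly (normalized_gegenbauer TYPE('n) j) (u \<bullet> y) * F y) =
    ?N j / (?\<mu> * poly (gegenbauer \<alpha> j) 1) * (LINT y|sphere_measure. poly (gegenbauer \<alpha> j) (u \<bullet> y) * F y)"
    by (simp add: normalized_gegenbauer_def Let_def \<alpha>[symmetric] mult.assoc flip: integral_mult_right_zero)
  also have "\<dots> = (if j = d then (?N j * \<alpha>) / ((\<alpha> + real j) * poly (gegenbauer \<alpha> j) 1) * F u else 0)"
    unfolding integral_gegenbauer_harmonic[OF n \<alpha> u F] using pos by simp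
  also have "\<dots> = (if j = d then F u else 0)"
    unfolding dim_harmonic_polys[OF n \<alpha>] using pos by (cases "j = d") (simp_all add: add_pos_nonneg less_imp_neq[symmetric])
  finally show ?thesis .
qed

theorem lemma1p2:
  fixes k s :: nat
    and a lam :: "nat \<Rightarrow> real"
    and h :: "real poly"
    and f :: "real ^ 'n \<Rightarrow> real"
    and F :: "nat \<Rightarrow> real ^ 'n \<Rightarrow> real"
  assumes "CARD('n) \<ge> 3"
    and "k > 0"
    and "h = (\<Sum>j\<le>s. monom (a (2 * j)) (2 * j))"
    and "\<forall>t\<in>{-1..1}. poly h t \<ge> 0"
    and "h = (\<Sum>j\<le>s. smult (lam (2 * j)) (normalized_gegenbauer TYPE('n) (2 * j)))"
    and "\<forall>j>s. lam (2 * j) = 0"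
    and "f \<in> homogeneous_polys (2 * k)"
    and "\<forall>j\<le>k. F (2 * j) \<in> harmonic_polys (2 * j)"
    and "f = (\<lambda>x. \<Sum>j\<le>k. norm x ^ (2 * (k - j)) * F (2 * j) x)"
  shows "Gamma_hat k h f = (\<lambda>x. \<Sum>j\<le>k. lam (2 * j) * norm x ^ (2 * (k - j)) * F (2 * j) x)"
proof
  fix x :: "real ^ 'n"
  note h = assms(3) and f = assms(7)
  have hF: "F (2 * j) \<in> homogeneous_polys (2 * j)" if "j \<le> k" for j
    using assms(8) that by (auto simp: harmonic_polys_def)
  have coeff: "coeff h (2 * j) = (if j \<le> s then a (2 * j) else 0)" for j
    by (simp add: h coeff_sum)
  have deg: "degree h div 2 \<le> s"
  proof -
    have "degree h \<le> 2 * s"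
      unfolding h by (rule degree_sum_le) (auto intro: order_trans[OF degree_monom_le])
    then show ?thesis by simp
  qed
  show "Gamma_hat k h f x = (\<Sum>j\<le>k. lam (2 * j) * norm x ^ (2 * (k - j)) * F (2 * j) x)"
  proof (cases "x = 0")
    case True
    \<comment> \<open>At the origin \<open>k > 0\<close> matters: the term \<open>j = 0\<close> is
      killed by the power of the norm, all others by the inner product.\<close>
    have "coeff h (2 * j) * norm x powi (2 * (int k - int j)) * (LINT y|sphere_measure. (x \<bullet> y) ^ (2 * j) * f y) = 0" for j
      using True \<open>k > 0\<close> by (cases "j = 0") (auto simp: power_int_0_left)
    then have "Gamma_hat k h f x = 0" unfolding Gamma_hat_def by (intro sum.neutral) blast
    moreover have "norm x ^ (2 * (k - j)) * F (2 * j) x = 0" if "j \<le> k" for j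
      using homogeneous_polys_scaleR[OF hF[OF that], of 0 0] True \<open>k > 0\<close> that
      by (cases "j = k") (simp_all add: power_0_left)
    then have "(\<Sum>j\<le>k. lam (2 * j) * norm x ^ (2 * (k - j)) * F (2 * j) x) = 0"
      by (intro sum.neutral) (simp add: mult.assoc)
    ultimately show ?thesis by simp
  next
    case False
    define u where "u = x /\<^sub>R norm x"
    have u: "norm u = 1" and xu: "x = norm x *\<^sub>R u" using False by (auto simp: u_def)
    have int: "integrable sphere_measure (\<lambda>y. poly p (u \<bullet> y) * G y)" if "G \<in> homogeneous_polys e" for p G e
      using that by (intro integrable_sphere_measure continuous_on_poly_inner_mult)
    \<comment> \<open>The factor \<open>norm x ^ (2 * j)\<close> pulled out of the inner product
      combines with the integer power to \<open>norm x ^ (2 * k)\<close> for every \<open>j\<close>,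
      including \<open>j > k\<close>, since \<open>x\<close> is nonzero.\<close>
    have "Gamma_hat k h f x = (\<Sum>j\<le>degree h div 2. coeff h (2 * j) * (norm x ^ (2 * k) *
        (LINT y|sphere_measure. (u \<bullet> y) ^ (2 * j) * f y)))"
      unfolding Gamma_hat_def
    proof (rule sum.cong)
      fix j
      have e1: "(LINT y|sphere_measure. (x \<bullet> y) ^ (2 * j) * f y) =
        norm x ^ (2 * j) * (LINT y|sphere_measure. (u \<bullet> y) ^ (2 * j) * f y)"
        by (subst xu) (simp add: power_mult_distrib mult.assoc)
      have e2: "norm x powi (2 * (int k - int j)) * norm x ^ (2 * j) = norm x ^ (2 * k)"
        using False power_int_add[of "norm x" "2 * (int k - int j)" "int (2 * j)"]
          power_int_of_nat[of "norm x" "2 * j"] power_int_of_nat[of "norm x" "2 * k"]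
        by (simp add: algebra_simps)
      show "coeff h (2 * j) * norm x powi (2 * (int k - int j)) * (LINT y|sphere_measure. (x \<bullet> y) ^ (2 * j) * f y)
        = coeff h (2 * j) * (norm x ^ (2 * k) * (LINT y|sphere_measure. (u \<bullet> y) ^ (2 * j) * f y))"
        unfolding e1 e2[symmetric] by (simp only: mult_ac)
    qed simp
    \<comment> \<open>Leading coefficients may vanish, so \<open>degree h div 2\<close> can be
      smaller than \<open>s\<close>; the added terms are zero.\<close>
    also have "\<dots> = (\<Sum>j\<le>s. a (2 * j) * (norm x ^ (2 * k) * (LINT y|sphere_measure. (u \<bullet> y) ^ (2 * j) * f y)))"
    proof (rule sum.mono_neutral_cong_left)
      show "\<forall>j\<in>{..s} - {..degree h div 2}. a (2 * j) * (norm x ^ (2 * k) *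
          (LINT y|sphere_measure. (u \<bullet> y) ^ (2 * j) * f y)) = 0"
      proof
        fix j assume j: "j \<in> {..s} - {..degree h div 2}"
        then have "degree h < 2 * j" by auto
        then have "a (2 * j) = 0" using coeff[of j] j by (simp add: coeff_eq_0)
        then show "a (2 * j) * (norm x ^ (2 * k) * (LINT y|sphere_measure. (u \<bullet> y) ^ (2 * j) * f y)) = 0" by simp
      qed
    qed (use deg coeff in auto)
    also have "\<dots> = norm x ^ (2 * k) * (LINT y|sphere_measure. poly h (u \<bullet> y) * f y)"
    proof -
      have "(LINT y|sphere_measure. poly h (u \<bullet> y) * f y) =
        (LINT y|sphere_measure. (\<Sum>j\<le>s. poly (monom (a (2 * j)) (2 * j)) (u \<bullet> y) * f y))"
        by (simp add: h poly_sum sum_distrib_right)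
      also have "\<dots> = (\<Sum>j\<le>s. (LINT y|sphere_measure. poly (monom (a (2 * j)) (2 * j)) (u \<bullet> y) * f y))"
        by (rule Bochner_Integration.integral_sum) (rule int[OF f])
      also have "\<dots> = (\<Sum>j\<le>s. a (2 * j) * (LINT y|sphere_measure. (u \<bullet> y) ^ (2 * j) * f y))"
        by (simp add: poly_monom mult.assoc)
      finally show ?thesis by (simp add: sum_distrib_left mult.left_commute)
    qed
    also have "(LINT y|sphere_measure. poly h (u \<bullet> y) * f y) =
        (LINT y|sphere_measure. (\<Sum>j\<le>k. \<Sum>i\<le>s. lam (2 * i) * (poly (normalized_gegenbauer TYPE('n) (2 * i)) (u \<bullet> y) * F (2 * j) y)))"
    proof (rule Bochner_Integration.integral_cong)
      fix y :: "real ^ 'n" assume "y \<in> space sphere_measure"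
      then have "f y = (\<Sum>j\<le>k. F (2 * j) y)" by (subst assms(9)) (simp add: space_sphere_measure)
      then show "poly h (u \<bullet> y) * f y = (\<Sum>j\<le>k. \<Sum>i\<le>s. lam (2 * i) * (poly (normalized_gegenbauer TYPE('n) (2 * i)) (u \<bullet> y) * F (2 * j) y))"
        by (subst assms(5)) (simp add: poly_sum sum_distrib_left sum_distrib_right mult.assoc)
    qed simp
    also have "\<dots> = (\<Sum>j\<le>k. \<Sum>i\<le>s. lam (2 * i) *
        (LINT y|sphere_measure. poly (normalized_gegenbauer TYPE('n) (2 * i)) (u \<bullet> y) * F (2 * j) y))"
    proof -
      have int': "integrable sphere_measure (\<lambda>y. lam (2 * i) *
          (poly (normalized_gegenbauer TYPE('n) (2 * i)) (u \<bullet> y) * F (2 * j) y))" if "j \<le> k" for i j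
        by (intro integrable_mult_right int[OF hF] that)
      then show ?thesis
        by (subst Bochner_Integration.integral_sum)
           (auto intro!: Bochner_Integration.integrable_sum sum.cong
             simp: Bochner_Integration.integral_sum[OF int'] simp del: integrable_mult_right_iff)
    qed
    also have "\<dots> = (\<Sum>j\<le>k. \<Sum>i\<le>s. if i = j then lam (2 * i) * F (2 * j) u else 0)"
      using assms(8) by (intro sum.cong refl)
        (auto simp: integral_normalized_gegenbauer_harmonic[OF assms(1) u, of _ "2 * _"])
    \<comment> \<open>For \<open>j > s\<close> no index \<open>i\<close> matches, and the convention
      \<open>lam (2 * j) = 0\<close> supplies the same value. Indices \<open>i > k\<close> meet no
      component of \<open>f\<close>.\<close>
    also have "\<dots> = (\<Sum>j\<le>k. lam (2 * j) * F (2 * j) u)"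
      using assms(6) by (intro sum.cong) auto
    also have "norm x ^ (2 * k) * \<dots> = (\<Sum>j\<le>k. lam (2 * j) * norm x ^ (2 * (k - j)) * F (2 * j) x)"
    proof -
      have "norm x ^ (2 * k) * (lam (2 * j) * F (2 * j) u) = lam (2 * j) * norm x ^ (2 * (k - j)) * F (2 * j) x" if "j \<le> k" for j
      proof -
        have "F (2 * j) x = norm x ^ (2 * j) * F (2 * j) u"
          by (subst xu) (rule homogeneous_polys_scaleR[OF hF[OF that]])
        moreover have "norm x ^ (2 * k) = norm x ^ (2 * (k - j)) * norm x ^ (2 * j)"
          using that by (simp flip: power_add distrib_left)
        ultimately show ?thesis by simp
      qed
      then show ?thesis unfolding sum_distrib_left by (intro sum.cong) auto
    qed
    finally show ?thesis .
  qed
qed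

end
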